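(* Let $L\ge 1$ and $M\geq 3$ be integers, and let $(X_n)_{n\ge 0}$ be the deterministic walk in an i.i.d. excited random environment on $\mathbb{Z}$ with maximal jump size $L$, with $M$ cookies per site and with cookie distribution $\mu$ (as defined in the context). Then there exists a function $\phi:[0,L]\to(-\infty,0]$ such that for each $\lambda\in[0,L]$ $$\lim_{n\to\infty}\frac1n\log\mathbb{P}\left(X_n\geq \lambda n\right)=\phi(\lambda).$$
   Context: For integers $a\le b$ write $[a,b]=\{a,a+1,\dots,b\}$. For positive integers $L,M$ the set of environments is $$\Omega=\Omega(L,M)=\left\{\omega\in[-L,L]^{\mathbb{Z}_{\ge0}\times\mathbb{Z}}:\ \omega(j,z)=\omega(M-1,z)\text{ for all } j\ge M-1 \text{ and all } z\in\mathbb{Z}\right\}.$$ The values $\omega(0,z),\dots,\omega(M-1,z)$ are called the cookies at $z$. $\Omega$ is equipped with the probability measure $\mathbb{P}$ under which $\{\omega(j,z): 0\le j\le M-1,\ z\in\mathbb{Z}\}$ are i.i.d. with distribution $\mu$ on $[-L,L]$, where $\mu(k)>0$ for every $k\in[-L,L]$. For $\omega\in\Omega$ the walk $X_t=X_t(\omega)$ is defined recursively by $X_0=0$ and $X_{t+1}=X_t+\omega(L_t(X_t),X_t)$, where $L_t(z)=L_t(\omega,z)=|\{0\le j<t: X_j=z\}|$ is the number of visits to $z$ during times $0,\dots,t-1$. *)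

theory Defs
  imports "HOL-Probability.Probability"
begin

(* The site is the second component: \<omega> (j, z) is the jump prescribed by the cookie used at the
   visit to z that is preceded by exactly j earlier visits. *)
type_synonym environment = "nat \<times> int \<Rightarrow> int"

definition environments :: "nat \<Rightarrow> nat \<Rightarrow> environment set" where
  "environments L M =
     {\<omega>. (\<forall>j z. \<omega> (j, z) \<in> {- int L..int L}) \<and>
          (\<forall>j z. M - 1 \<le> j \<longrightarrow> \<omega> (j, z) = \<omega> (M - 1, z))}"

(* Product sigma-algebra, restricted to the environments. *)
definition environment_algebra :: "nat \<Rightarrow> nat \<Rightarrow> environment measure" where
  "environment_algebra L M =
     restrict_space (\<Pi>\<^sub>M i\<in>UNIV. count_space UNIV) (environments L M)"

definition cookie_sites :: "nat \<Rightarrow> (nat \<times> int) set" where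
  "cookie_sites M = {..<M} \<times> UNIV"

(* Only the cookies with index j < M are required to be independent; those with j \<ge> M are copies of
   the cookie M - 1 by the definition of environments. *)
definition iid_cookie_measure :: "nat \<Rightarrow> nat \<Rightarrow> int pmf \<Rightarrow> environment measure \<Rightarrow> bool" where
  "iid_cookie_measure L M \<mu> P \<longleftrightarrow>
     prob_space P \<and>
     space P = environments L M \<and>
     sets P = sets (environment_algebra L M) \<and>
     prob_space.indep_vars P (\<lambda>_. count_space UNIV) (\<lambda>i \<omega>. \<omega> i) (cookie_sites M) \<and>
     (\<forall>i\<in>cookie_sites M. distr P (count_space UNIV) (\<lambda>\<omega>. \<omega> i) = measure_pmf \<mu>)"

definition visits :: "(nat \<Rightarrow> int) \<Rightarrow> nat \<Rightarrow> int \<Rightarrow> nat" where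
  "visits X t z = card {j. j < t \<and> X j = z}"

(* Lets the termination proof of walk see that visits X t only inspects X before time t. *)
lemma visits_cong [fundef_cong]:
  assumes "t = t'" "z = z'" "\<And>j. j < t' \<Longrightarrow> X j = Y j"
  shows "visits X t z = visits Y t' z'"
proof -
  have "{j. j < t \<and> X j = z} = {j. j < t' \<and> Y j = z'}"
    using assms by auto
  then show ?thesis by (simp add: visits_def)
qed

fun walk :: "environment \<Rightarrow> nat \<Rightarrow> int" where
  "walk \<omega> 0 = 0"
| "walk \<omega> (Suc t) =
     walk \<omega> t + \<omega> (visits (\<lambda>j. walk \<omega> j) t (walk \<omega> t), walk \<omega> t)"

(* The predicate is satisfiable whenever \<mu> is a distribution on [-L, L]. *)
lemma iid_cookie_measure_exists:
  assumes "set_pmf \<mu> \<subseteq> {- int L..int L}" "M \<ge> 1"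
  shows "\<exists>P. iid_cookie_measure L M \<mu> P"
proof -
  let ?N = "\<Pi>\<^sub>M i\<in>(UNIV :: (nat \<times> int) set). measure_pmf \<mu>"
  define g :: "int \<Rightarrow> int" where "g x = max (- int L) (min (int L) x)" for x
  define f :: "environment \<Rightarrow> environment"
    where "f c = (\<lambda>(j, z). g (c (min j (M - 1), z)))" for c
  let ?P = "distr ?N (environment_algebra L M) f"
  interpret N: product_prob_space "\<lambda>_. measure_pmf \<mu>" "UNIV :: (nat \<times> int) set"
    by unfold_locales
  have coord: "(\<lambda>c. c i) \<in> measurable ?N (count_space UNIV)" for i
    using measurable_component_singleton[of i UNIV "\<lambda>_. measure_pmf \<mu>"] by simp
  have f_env: "f c \<in> environments L M" for c
    by (auto simp: f_def g_def environments_def)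
  have f_coord: "(\<lambda>c. f c i) \<in> measurable ?N (count_space UNIV)" for i
  proof -
    have "(\<lambda>c. g (c (min (fst i) (M - 1), snd i))) \<in> measurable ?N (count_space UNIV)"
      by (rule measurable_compose[OF coord]) simp
    then show ?thesis by (simp add: f_def case_prod_beta)
  qed
  have "f \<in> measurable ?N (\<Pi>\<^sub>M i\<in>UNIV. count_space UNIV)"
    by (rule measurable_PiM_single') (auto simp: f_coord)
  then have f_meas: "f \<in> measurable ?N (environment_algebra L M)"
    unfolding environment_algebra_def
    by (intro measurable_restrict_space2) (auto simp: f_env)
  have f_eq: "f c i = g (c i)" if "i \<in> cookie_sites M" for c i
    using that by (auto simp: f_def cookie_sites_def min_def)
  have prob: "prob_space ?P"
    by (rule N.prob_space_distr[OF f_meas])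
  have space: "space ?P = environments L M"
    by (simp add: environment_algebra_def space_restrict_space space_PiM)
  have alg_coord: "(\<lambda>\<omega>. \<omega> i) \<in> measurable (environment_algebra L M) (count_space UNIV)" for i
    unfolding environment_algebra_def
    by (intro measurable_restrict_space1 measurable_component_singleton) simp
  have N_indep: "N.indep_vars (\<lambda>_. measure_pmf \<mu>) (\<lambda>i c. c i) UNIV"
  proof -
    have "distr ?N ?N (\<lambda>c. \<lambda>i\<in>UNIV. c i) = ?N"
      by (simp add: restrict_UNIV)
    moreover have "distr ?N (measure_pmf \<mu>) (\<lambda>c. c i) = measure_pmf \<mu>" for i
      by (rule N.PiM_component) simp
    ultimately show ?thesis
      by (subst N.indep_vars_iff_distr_eq_PiM) auto
  qed
  have "N.indep_vars (\<lambda>_. count_space UNIV) (\<lambda>i c. g (c i)) UNIV"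
    by (rule N.indep_vars_compose2[OF N_indep]) simp
  then have "N.indep_vars (\<lambda>_. count_space UNIV) (\<lambda>i c. g (c i)) (cookie_sites M)"
    by (rule N.indep_vars_subset) simp
  then have f_indep: "N.indep_vars (\<lambda>_. count_space UNIV) (\<lambda>i c. f c i) (cookie_sites M)"
    by (subst N.indep_vars_cong[OF refl _ refl, where Y = "\<lambda>i c. g (c i)"])
      (auto simp: f_eq)
  have ne: "cookie_sites M \<noteq> {}"
    using assms by (auto simp: cookie_sites_def lessThan_empty_iff)
  have distr_coord:
    "distr ?P (count_space UNIV) (\<lambda>\<omega>. \<omega> i) = distr ?N (count_space UNIV) (\<lambda>c. f c i)" for i
    by (simp add: distr_distr[OF alg_coord f_meas] comp_def)
  have restr: "(\<lambda>\<omega>. \<lambda>i\<in>cookie_sites M. \<omega> i) \<in>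
      measurable (environment_algebra L M) (\<Pi>\<^sub>M i\<in>cookie_sites M. count_space UNIV)"
    by (rule measurable_restrict) (rule alg_coord)
  have indep:
    "prob_space.indep_vars ?P (\<lambda>_. count_space UNIV) (\<lambda>i \<omega>. \<omega> i) (cookie_sites M)"
    using f_indep
    by (simp add: prob_space.indep_vars_iff_distr_eq_PiM'[OF prob ne]
        N.indep_vars_iff_distr_eq_PiM'[OF ne] alg_coord f_coord distr_coord
        distr_distr[OF restr f_meas] comp_def)
  have marginal: "distr ?P (count_space UNIV) (\<lambda>\<omega>. \<omega> i) = measure_pmf \<mu>"
    if i: "i \<in> cookie_sites M" for i
  proof -
    have "distr ?N (count_space UNIV) (\<lambda>c. f c i) =
        distr (distr ?N (measure_pmf \<mu>) (\<lambda>c. c i)) (count_space UNIV) g"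
      using coord[of i] by (subst distr_distr) (auto simp: comp_def f_eq[OF i])
    also have "distr ?N (measure_pmf \<mu>) (\<lambda>c. c i) = measure_pmf \<mu>"
      by (rule N.PiM_component) simp
    also have "distr (measure_pmf \<mu>) (count_space UNIV) g = measure_pmf (map_pmf g \<mu>)"
      by (simp add: map_pmf_rep_eq)
    also have "map_pmf g \<mu> = \<mu>"
      using assms by (intro map_pmf_idI) (auto simp: g_def subset_iff)
    finally show ?thesis by (simp add: distr_coord)
  qed
  show ?thesis
    unfolding iid_cookie_measure_def using prob space indep marginal by (intro exI[of _ ?P]) simp
qed

end

theory Submission
  imports Defs
begin

text \<open>
Let \<open>h x n\<close> (below: \<open>advance_prob x n\<close>) be the probability that the walk, started at 0, reaches
\<open>[x, \<infinity>)\<close> within \<open>n\<close> steps without visiting a negative site before. When it first reaches \<open>[x, \<infinity>)\<close>,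
every site from there on is fresh, so a new such walk can be started there, on cookies that are
independent of the past. Hence \<open>h x n * h y m \<le> h (x + y) (n + m)\<close>, and the numbers
\<open>ln (h \<lceil>\<lambda> n\<rceil> n)\<close> are superadditive and have a linear growth rate \<open>\<phi>\<close>. It remains to compare
\<open>h \<lceil>\<lambda> n\<rceil> n\<close> with the probability of \<open>X n \<ge> \<lambda> n\<close>, up to factors that are subexponential in \<open>n\<close>.

One direction is easy: a walk that has reached its goal meets, with probability \<open>\<mu> 0 ^ M\<close>, a site
whose cookies are all 0, and stays there. The other direction has to get rid of the excursions of the
walk to the left of its starting point. Since the walk makes at most \<open>L n\<close> upcrossings of integer
levels in \<open>n\<close> steps, one of the levels \<open>d = 1, \<dots>, \<Delta>\<close> with \<open>\<Delta> \<approx> L n / (K + 1)\<close> is crossed upwards at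
most \<open>K\<close> times. To the sites at and above \<open>d\<close> everything below \<open>d\<close> matters only through the finite
list saying where the walk first enters \<open>[d, \<infinity>)\<close>, and where each excursion below \<open>d\<close> starts and
returns. There are finitely many such lists, independently of \<open>n\<close>. For each of them
\<open>leftmost_gadget\<close> builds a finite environment on sites below \<open>d\<close>, which has positive probability and in
which the walk, started at the leftmost site, produces the same list. Replacing everything below \<open>d\<close>
by this environment costs a constant factor and a constant number of extra steps, and turns the walk
into one that never goes below its starting point. Apart from a factor of order \<open>\<Delta>\<close>, the
loss is thus only a shift of the goal by at most \<open>\<Delta>\<close>, and \<open>K\<close> can be chosen large afterwards.

The gadget keeps, at each of the \<open>L\<close> sites just below \<open>d\<close>, only the visits of the given walk that start
or end an excursion. An excursion starting at \<open>a\<close> and leaving from \<open>e \<noteq> a\<close> is led down the residue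
class of \<open>a\<close> modulo \<open>L\<close> by jumps \<open>- L\<close>, crosses over to the class of \<open>e\<close> at a depth of its own, and
climbs back by jumps \<open>L\<close>. The list of jumps made at a site near \<open>d\<close> is then a thinned out copy of the
list of the given walk, and so becomes constant after \<open>M\<close> cookies as well. Deeper sites are not
visited by the earlier excursions, which makes room for the crossing cookie, and for the very first
passage. At the site of a crossing these two may come before the constant part: this is where
\<open>M \<ge> 3\<close> enters.
\<close>

section \<open>Running a walk on stacks of cookies\<close>

type_synonym stacks = "int \<Rightarrow> nat \<Rightarrow> int"

text \<open>
The walk is followed through the cookies that are still left: a state consists of a position and of the
stack of remaining cookies at each site, and a step removes the top cookie of the current stack. The
future then depends on the state alone, which makes excursions composable.
\<close>

definition pop :: "int \<Rightarrow> stacks \<Rightarrow> stacks" where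
  "pop z S = S(z := (\<lambda>j. S z (Suc j)))"

text \<open>
\<open>leave A S u k S' v\<close>: started at \<open>u\<close> with stacks \<open>S\<close>, the walk steps out of \<open>A\<close> for the first time at
time \<open>k\<close>, at the site \<open>v\<close>, and the stacks are then \<open>S'\<close>.
\<close>

inductive leave :: "int set \<Rightarrow> stacks \<Rightarrow> int \<Rightarrow> nat \<Rightarrow> stacks \<Rightarrow> int \<Rightarrow> bool"
  for A :: "int set" where
  stop: "u \<notin> A \<Longrightarrow> leave A S u 0 S u"
| move: "u \<in> A \<Longrightarrow> leave A (pop u S) (u + S u 0) k S' v \<Longrightarrow> leave A S u (Suc k) S' v"

lemma leave_notin: "leave A S u k S' v \<Longrightarrow> v \<notin> A"
  by (induction rule: leave.induct) auto

lemma leave_outside: "leave A S u k S' v \<Longrightarrow> z \<notin> A \<Longrightarrow> S' z = S z"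
  by (induction rule: leave.induct) (auto simp: pop_def)

text \<open>
This locality is what allows the sites on one side of a level to be changed without disturbing the walk
on the other side.
\<close>

lemma leave_local:
  assumes "leave A S u k S' v" "\<And>z. z \<in> A \<Longrightarrow> R z = S z"
  shows "leave A R u k (\<lambda>z. if z \<in> A then S' z else R z) v"
  using assms
proof (induction arbitrary: R rule: leave.induct)
  case (stop u S)
  have "(\<lambda>z. if z \<in> A then S z else R z) = R" using stop by auto
  then show ?case using stop by (auto intro: leave.stop)
next
  case (move u S k S' v)
  have "leave A (pop u R) (u + S u 0) k (\<lambda>z. if z \<in> A then S' z else pop u R z) v"
    using move.prems by (intro move.IH) (auto simp: pop_def)
  moreover have "(\<lambda>z. if z \<in> A then S' z else pop u R z) = (\<lambda>z. if z \<in> A then S' z else R z)"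
    using move.hyps by (auto simp: pop_def)
  ultimately show ?case using move.hyps move.prems by (auto intro: leave.move)
qed

lemma leave_trans:
  assumes "leave A S u k S1 v" "leave A' S1 v k' S2 w" "A \<subseteq> A'"
  shows "leave A' S u (k + k') S2 w"
  using assms by (induction rule: leave.induct) (auto intro: leave.move)

lemma leave_mono: "leave A S u k S' v \<Longrightarrow> A \<subseteq> A' \<Longrightarrow> v \<notin> A' \<Longrightarrow> leave A' S u k S' v"
  using leave_trans[OF _ leave.stop, of A S u k S' v A'] by simp

lemma leave_det:
  assumes "leave A S u k S' v" "leave A S u l S'' w"
  shows "k = l \<and> S' = S'' \<and> v = w"
  using assms
proof (induction arbitrary: l rule: leave.induct)
  case (stop u S)
  then show ?case by (auto elim: leave.cases)
next
  case (move u S k S' v)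
  from move.prems move.hyps(1) obtain l' where "l = Suc l'"
    "leave A (pop u S) (u + S u 0) l' S'' w"
    by (auto elim: leave.cases)
  then show ?case using move.IH by auto
qed

lemma leave_subset:
  assumes "leave A S u k S' v" "B \<subseteq> A"
  shows "\<exists>j\<le>k. \<exists>S'' w. leave B S u j S'' w \<and> w \<in> insert v A"
  using assms
proof (induction rule: leave.induct)
  case (stop u S)
  then show ?case by (auto intro!: leave.stop)
next
  case (move u S k S' v)
  show ?case
  proof (cases "u \<in> B")
    case True
    from move.IH[OF move.prems] obtain j S'' w
      where "j \<le> k" "leave B (pop u S) (u + S u 0) j S'' w" "w \<in> insert v A" by blast
    then show ?thesis using True by (intro exI[of _ "Suc j"]) (auto intro: leave.move)
  next
    case False
    then show ?thesis using move.hyps by (intro exI[of _ 0]) (auto intro: leave.stop)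
  qed
qed

lemma leave_translate:
  assumes "leave A S u k S' v"
  shows "leave ((\<lambda>z. z - d) ` A) (\<lambda>z. S (z + d)) (u - d) k (\<lambda>z. S' (z + d)) (v - d)"
  using assms
proof (induction rule: leave.induct)
  case (stop u S)
  then show ?case by (intro leave.stop) auto
next
  case (move u S k S' v)
  have "(\<lambda>z. pop u S (z + d)) = pop (u - d) (\<lambda>z. S (z + d))"
    by (auto simp: pop_def fun_eq_iff)
  then show ?case using move by (intro leave.move) (auto simp: algebra_simps)
qed

text \<open>
The sites of \<open>A\<close> are regarded as a device with a memory: a walk that is put into \<open>A\<close> at \<open>a\<close> comes out at
some \<open>b\<close>, and the next visit finds the stacks as they were left. The list records (entry, exit) pairs,
and \<open>n\<close> bounds the total time spent in \<open>A\<close>.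
\<close>

fun answers :: "int set \<Rightarrow> stacks \<Rightarrow> (int \<times> int) list \<Rightarrow> nat \<Rightarrow> bool" where
  "answers A S [] n \<longleftrightarrow> True"
| "answers A S ((a, b) # \<tau>) n \<longleftrightarrow>
     (\<exists>k\<le>n. \<exists>S'. leave A S a k S' b \<and> answers A S' \<tau> (n - k))"

text \<open>
A walk that alternates between the negative and the nonnegative sites has one list of (entry, exit) pairs
for each side, and the exits of one side are the entries of the other. If \<open>\<tau>\<close> lists the excursions to
the negative sites, \<open>b\<close> is the first entry to the nonnegative ones, and \<open>z\<close> is the final exit, then
\<open>chain b \<tau> z\<close> is the list for the nonnegative side.
\<close>

fun chain :: "int \<Rightarrow> (int \<times> int) list \<Rightarrow> int \<Rightarrow> (int \<times> int) list" where
  "chain b [] z = [(b, z)]"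
| "chain b ((a, b') # \<tau>) z = (b, a) # chain b' \<tau> z"

lemma answers_local:
  "answers A S \<tau> n \<Longrightarrow> (\<And>z. z \<in> A \<Longrightarrow> R z = S z) \<Longrightarrow> answers A R \<tau> n"
proof (induction \<tau> arbitrary: S R n)
  case (Cons ab \<tau>)
  obtain a b where ab: "ab = (a, b)" by force
  from Cons.prems(1) obtain k S' where k: "k \<le> n" "leave A S a k S' b" "answers A S' \<tau> (n - k)"
    by (auto simp: ab)
  let ?R = "\<lambda>z. if z \<in> A then S' z else R z"
  have "leave A R a k ?R b" by (rule leave_local[OF k(2) Cons.prems(2)])
  moreover have "answers A ?R \<tau> (n - k)" by (rule Cons.IH[OF k(3)]) simp
  ultimately show ?case using k(1) unfolding ab answers.simps by blast
qed simp

lemma answers_mono: "answers A S \<tau> n \<Longrightarrow> n \<le> m \<Longrightarrow> answers A S \<tau> m"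
proof (induction \<tau> arbitrary: S n m)
  case (Cons ab \<tau>)
  obtain a b where ab: "ab = (a, b)" by force
  from Cons.prems(1) obtain k S' where k: "k \<le> n" "leave A S a k S' b" "answers A S' \<tau> (n - k)"
    by (auto simp: ab)
  have "answers A S' \<tau> (m - k)" by (rule Cons.IH[OF k(3)]) (use Cons.prems in simp)
  moreover have "k \<le> m" using k Cons.prems by simp
  ultimately show ?case using k(2) unfolding ab answers.simps by blast
qed simp

text \<open>
Each side only uses its own stacks, so two matching lists, each realized on its own side, can be
interleaved to a run of the whole walk.
\<close>

lemma leave_of_answers:
  assumes "answers {p..<0} S \<tau> T" "answers {0..<x} S (chain b \<tau> z) n" "x \<le> z" "p \<le> 0" "0 \<le> x"
  shows "\<exists>k\<le>T + n. \<exists>S'. leave {p..<x} S b k S' z"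
  using assms(1,2)
proof (induction \<tau> arbitrary: S b T n)
  case Nil
  then obtain k S' where k: "k \<le> n" "leave {0..<x} S b k S' z" by auto
  have "leave {p..<x} S b k S' z"
    by (rule leave_mono[OF k(2)]) (use assms in auto)
  then show ?case using k by (intro exI[of _ k]) auto
next
  case (Cons ab \<tau>)
  obtain a b' where ab: "ab = (a, b')" by force
  from Cons.prems(2) obtain k1 S1 where 1: "k1 \<le> n" "leave {0..<x} S b k1 S1 a"
    "answers {0..<x} S1 (chain b' \<tau> z) (n - k1)" by (auto simp: ab)
  from Cons.prems(1) obtain k2 S2 where 2: "k2 \<le> T" "leave {p..<0} S a k2 S2 b'"
    "answers {p..<0} S2 \<tau> (T - k2)" by (auto simp: ab)
  define R where "R = (\<lambda>z. if z \<in> {p..<0} then S2 z else S1 z)"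
  have R: "leave {p..<0} S1 a k2 R b'" unfolding R_def
    by (rule leave_local[OF 2(2)]) (use leave_outside[OF 1(2)] in auto)
  have "answers {p..<0} R \<tau> (T - k2)"
    by (rule answers_local[OF 2(3)]) (auto simp: R_def)
  moreover have "answers {0..<x} R (chain b' \<tau> z) (n - k1)"
    by (rule answers_local[OF 1(3)]) (auto simp: R_def)
  ultimately obtain k S' where k: "k \<le> (T - k2) + (n - k1)" "leave {p..<x} R b' k S' z"
    using Cons.IH by blast
  have "leave {p..<x} S1 a (k2 + k) S' z"
    by (rule leave_trans[OF R k(2)]) (use assms in auto)
  then have "leave {p..<x} S b (k1 + (k2 + k)) S' z"
    by (rule leave_trans[OF 1(2)]) (use assms in auto)
  then show ?case using k 1 2 by (intro exI[of _ "k1 + (k2 + k)"]) auto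
qed

fun upcrossings :: "int \<Rightarrow> stacks \<Rightarrow> int \<Rightarrow> nat \<Rightarrow> nat" where
  "upcrossings D S u 0 = 0"
| "upcrossings D S u (Suc k) =
     (if u < D \<and> D \<le> u + S u 0 then 1 else 0) + upcrossings D (pop u S) (u + S u 0) k"

lemma upcrossings_translate:
  "upcrossings D S u k = upcrossings 0 (\<lambda>z. S (z + D)) (u - D) k"
proof (induction k arbitrary: S u)
  case (Suc k)
  have "(\<lambda>z. pop u S (z + D)) = pop (u - D) (\<lambda>z. S (z + D))"
    by (auto simp: pop_def fun_eq_iff)
  moreover have "u + S u 0 - D = u - D + S (u - D + D) 0" by simp
  ultimately have "upcrossings D (pop u S) (u + S u 0) k =
      upcrossings 0 (pop (u - D) (\<lambda>z. S (z + D))) (u - D + S (u - D + D) 0) k"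
    using Suc[of "pop u S" "u + S u 0"] by metis
  moreover have "u < D \<and> D \<le> u + S u 0 \<longleftrightarrow> u - D < 0 \<and> 0 \<le> u - D + S (u - D + D) 0" by auto
  ultimately show ?case by (simp only: upcrossings.simps)
qed simp

text \<open>
A jump of size at most \<open>L\<close> crosses at most \<open>L\<close> levels.
\<close>

lemma sum_upcrossings:
  assumes "\<And>z j. S z j \<le> int L" "finite I"
  shows "(\<Sum>D\<in>I. upcrossings D S u k) \<le> L * k"
  using assms(1)
proof (induction k arbitrary: S u)
  case (Suc k)
  have "(\<Sum>D\<in>I. if u < D \<and> D \<le> u + S u 0 then 1 else 0) = card {D\<in>I. u < D \<and> D \<le> u + S u 0}"
    by (subst sum.inter_filter[OF assms(2), symmetric]) simp
  also have "\<dots> \<le> card {u<..u + S u 0}" by (intro card_mono) auto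
  also have "\<dots> \<le> L" using Suc.prems[of u 0] by simp
  finally have "(\<Sum>D\<in>I. if u < D \<and> D \<le> u + S u 0 then 1 else 0) \<le> L" .
  moreover have "(\<Sum>D\<in>I. upcrossings D (pop u S) (u + S u 0) k) \<le> L * k"
    using Suc.prems by (intro Suc.IH) (auto simp: pop_def)
  ultimately show ?case by (simp add: sum.distrib)
qed simp

lemma answers_chain_move:
  assumes "u \<in> A" "answers A (pop u S) (chain (u + S u 0) \<tau> z) n"
  shows "answers A S (chain u \<tau> z) (Suc n)"
proof -
  have *: "\<exists>k\<le>Suc n. \<exists>S'. leave A S u k S' v \<and> answers A S' \<rho> (Suc n - k)"
    if "\<exists>k\<le>n. \<exists>S'. leave A (pop u S) (u + S u 0) k S' v \<and> answers A S' \<rho> (n - k)" for v \<rho>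
  proof -
    from that obtain k S' where k: "k \<le> n" "leave A (pop u S) (u + S u 0) k S' v" "answers A S' \<rho> (n - k)"
      by blast
    then show ?thesis by (intro exI[of _ "Suc k"] conjI exI[of _ S']) (auto intro: leave.move assms)
  qed
  show ?thesis
  proof (cases \<tau>)
    case Nil
    then show ?thesis using assms *[of z "[]"] by simp
  next
    case (Cons ab \<tau>')
    obtain a b where "ab = (a, b)" by force
    then show ?thesis using Cons assms *[of a "chain b \<tau>' z"] by simp
  qed
qed

lemma answers_move:
  assumes "u \<in> A" "answers A (pop u S) ((u + S u 0, b) # \<tau>) n"
  shows "answers A S ((u, b) # \<tau>) (Suc n)"
proof -
  from assms obtain k S' where k: "k \<le> n" "leave A (pop u S) (u + S u 0) k S' b" "answers A S' \<tau> (n - k)"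
    by auto
  then have "leave A S u (Suc k) S' b" using assms(1) by (blast intro: leave.move)
  then show ?thesis using k by (auto intro!: exI[of _ "Suc k"])
qed

text \<open>
The converse of \<open>leave_of_answers\<close>, with a bound on the number of excursions. Induction over the steps
requires both starting sides at once.
\<close>

lemma split_at_origin:
  assumes "leave {..<x} S u k S' v" "0 \<le> x" "\<And>z j. S z j \<in> {- int L..int L}"
  shows "(u < 0 \<longrightarrow> (\<exists>b \<tau>. answers {..<0} S ((u, b) # \<tau>) k \<and> answers {0..<x} S (chain b \<tau> v) k \<and>
            length \<tau> + 1 \<le> upcrossings 0 S u k \<and> b \<in> {0..<int L} \<and> set \<tau> \<subseteq> {- int L..-1} \<times> {0..<int L})) \<and>
         (0 \<le> u \<longrightarrow> (\<exists>\<tau>. answers {..<0} S \<tau> k \<and> answers {0..<x} S (chain u \<tau> v) k \<and>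
            length \<tau> \<le> upcrossings 0 S u k \<and> set \<tau> \<subseteq> {- int L..-1} \<times> {0..<int L}))"
  using assms
proof (induction rule: leave.induct)
  case (stop u S)
  then have "leave {0..<x} S u 0 S u" by (intro leave.stop) auto
  then have "answers {0..<x} S (chain u [] u) 0" by auto
  moreover have "0 \<le> u" using stop by auto
  ultimately show ?case by (intro conjI impI exI[of _ "[]"]) auto
next
  case (move u S k S' v)
  let ?u = "u + S u 0" and ?S = "pop u S"
  have bnd: "?S z j \<in> {- int L..int L}" for z j using move.prems(2) by (auto simp: pop_def)
  note IHneg = move.IH[OF move.prems(1) bnd, THEN conjunct1, rule_format]
  note IHpos = move.IH[OF move.prems(1) bnd, THEN conjunct2, rule_format]
  have jump: "S u 0 \<in> {- int L..int L}" by (rule move.prems)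
  have loc: "answers A S \<rho> n" if "answers A ?S \<rho> n" "u \<notin> A" for A \<rho> n
    by (rule answers_local[OF that(1)]) (use that(2) in \<open>auto simp: pop_def\<close>)
  consider "u < 0" "?u < 0" | "u < 0" "0 \<le> ?u" | "0 \<le> u" "?u < 0" | "0 \<le> u" "0 \<le> ?u"
    by linarith
  then show ?case
  proof cases
    case 1
    from IHneg[OF this(2)] obtain b \<tau> where b: "answers {..<0} ?S ((?u, b) # \<tau>) k" "answers {0..<x} ?S (chain b \<tau> v) k"
      "length \<tau> + 1 \<le> upcrossings 0 ?S ?u k" "b \<in> {0..<int L}" "set \<tau> \<subseteq> {- int L..-1} \<times> {0..<int L}"
      by (elim exE conjE) (rule that)
    have "answers {..<0} S ((u, b) # \<tau>) (Suc k)" by (rule answers_move) (use 1 b in auto)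
    moreover have "answers {0..<x} S (chain b \<tau> v) (Suc k)"
      by (rule answers_mono[OF loc[OF b(2)]]) (use 1 in auto)
    moreover have "length \<tau> + 1 \<le> upcrossings 0 S u (Suc k)" using b 1 by simp
    ultimately have "\<exists>b \<tau>. answers {..<0} S ((u, b) # \<tau>) (Suc k) \<and>
        answers {0..<x} S (chain b \<tau> v) (Suc k) \<and> length \<tau> + 1 \<le> upcrossings 0 S u (Suc k) \<and>
        b \<in> {0..<int L} \<and> set \<tau> \<subseteq> {- int L..-1} \<times> {0..<int L}"
      using b(4,5) by (intro exI[of _ b] exI[of _ \<tau>] conjI)
    then show ?thesis using 1 by simp
  next
    case 2
    from IHpos[OF this(2)] obtain \<tau> where b: "answers {..<0} ?S \<tau> k" "answers {0..<x} ?S (chain ?u \<tau> v) k"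
      "length \<tau> \<le> upcrossings 0 ?S ?u k" "set \<tau> \<subseteq> {- int L..-1} \<times> {0..<int L}"
      by (elim exE conjE) (rule that)
    have "leave {..<0} ?S ?u 0 ?S ?u" using 2 by (intro leave.stop) auto
    then have "answers {..<0} ?S ((?u, ?u) # \<tau>) k" using b(1) by (auto intro!: exI[of _ 0])
    then have "answers {..<0} S ((u, ?u) # \<tau>) (Suc k)" by (intro answers_move) (use 2 in auto)
    moreover have "answers {0..<x} S (chain ?u \<tau> v) (Suc k)"
      by (rule answers_mono[OF loc[OF b(2)]]) (use 2 in auto)
    moreover have "?u \<in> {0..<int L}" using 2 jump by auto
    moreover have "length \<tau> + 1 \<le> upcrossings 0 S u (Suc k)" using b 2 by simp
    ultimately have "\<exists>b \<tau>. answers {..<0} S ((u, b) # \<tau>) (Suc k) \<and>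
        answers {0..<x} S (chain b \<tau> v) (Suc k) \<and> length \<tau> + 1 \<le> upcrossings 0 S u (Suc k) \<and>
        b \<in> {0..<int L} \<and> set \<tau> \<subseteq> {- int L..-1} \<times> {0..<int L}"
      using b(4) by (intro exI[of _ ?u] exI[of _ \<tau>] conjI)
    then show ?thesis using 2 by simp
  next
    case 3
    from IHneg[OF this(2)] obtain b \<tau> where b: "answers {..<0} ?S ((?u, b) # \<tau>) k" "answers {0..<x} ?S (chain b \<tau> v) k"
      "length \<tau> + 1 \<le> upcrossings 0 ?S ?u k" "b \<in> {0..<int L}" "set \<tau> \<subseteq> {- int L..-1} \<times> {0..<int L}"
      by (elim exE conjE) (rule that)
    have "answers {..<0} S ((?u, b) # \<tau>) (Suc k)"
      by (rule answers_mono[OF loc[OF b(1)]]) (use 3 in auto)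
    moreover have "answers {0..<x} S (chain u ((?u, b) # \<tau>) v) (Suc k)"
    proof (rule answers_chain_move)
      show "u \<in> {0..<x}" using 3 move.hyps by auto
      have "leave {0..<x} ?S ?u 0 ?S ?u" using 3 by (intro leave.stop) auto
      then show "answers {0..<x} ?S (chain ?u ((?u, b) # \<tau>) v) k"
        using b(2) by (auto intro!: exI[of _ 0])
    qed
    moreover have "length ((?u, b) # \<tau>) \<le> upcrossings 0 S u (Suc k)" using b 3 by simp
    moreover have "set ((?u, b) # \<tau>) \<subseteq> {- int L..-1} \<times> {0..<int L}" using b 3 jump by simp
    ultimately have "\<exists>\<tau>. answers {..<0} S \<tau> (Suc k) \<and> answers {0..<x} S (chain u \<tau> v) (Suc k) \<and>
        length \<tau> \<le> upcrossings 0 S u (Suc k) \<and> set \<tau> \<subseteq> {- int L..-1} \<times> {0..<int L}"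
      by (intro exI[of _ "(?u, b) # \<tau>"] conjI)
    then show ?thesis using 3 by simp
  next
    case 4
    from IHpos[OF this(2)] obtain \<tau> where b: "answers {..<0} ?S \<tau> k" "answers {0..<x} ?S (chain ?u \<tau> v) k"
      "length \<tau> \<le> upcrossings 0 ?S ?u k" "set \<tau> \<subseteq> {- int L..-1} \<times> {0..<int L}"
      by (elim exE conjE) (rule that)
    have "answers {..<0} S \<tau> (Suc k)"
      by (rule answers_mono[OF loc[OF b(1)]]) (use 4 in auto)
    moreover have "answers {0..<x} S (chain u \<tau> v) (Suc k)"
      by (rule answers_chain_move) (use b 4 move.hyps in auto)
    moreover have "length (\<tau>) \<le> upcrossings 0 S u (Suc k)" using b 4 by simp
    moreover have "set (\<tau>) \<subseteq> {- int L..-1} \<times> {0..<int L}" using b  by simp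
    ultimately have "\<exists>\<tau>. answers {..<0} S \<tau> (Suc k) \<and> answers {0..<x} S (chain u \<tau> v) (Suc k) \<and>
        length \<tau> \<le> upcrossings 0 S u (Suc k) \<and> set \<tau> \<subseteq> {- int L..-1} \<times> {0..<int L}"
      by (intro exI[of _ "\<tau>"] conjI)
    then show ?thesis using 4 by simp
  qed
qed

section \<open>A finite environment that answers prescribed excursions\<close>

text \<open>
The gadget is constructed backwards in time: the stacks needed before a step are those needed after it with
the jump of this step put on top. In this way any finite path can be prescribed, and what needs proof is
only that the resulting stacks are constant from the cookie \<open>M - 1\<close> on.
\<close>

definition push :: "int \<Rightarrow> int \<Rightarrow> stacks \<Rightarrow> stacks" where
  "push z c S = S(z := case_nat c (S z))"

lemma push_apply: "push z c S y = (if y = z then case_nat c (S y) else S y)"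
  by (simp add: push_def)

lemma pop_push [simp]: "pop z (push z c S) = S"
  by (auto simp: pop_def push_def)

lemma leave_push:
  assumes "u \<in> A" "leave A S (u + c) k S' v"
  shows "leave A (push u c S) u (Suc k) S' v"
  using assms by (intro leave.move) (auto simp: push_apply)

text \<open>
\<open>climb l e k\<close> makes a walk started at \<open>e - k l\<close> jump up to \<open>e\<close> in steps of length \<open>l\<close>, and \<open>descend l a k\<close>
makes a walk started at \<open>a\<close> jump down to \<open>a - k l\<close>.
\<close>

primrec climb :: "int \<Rightarrow> int \<Rightarrow> nat \<Rightarrow> stacks \<Rightarrow> stacks" where
  "climb l e 0 S = S"
| "climb l e (Suc k) S = push (e - int (Suc k) * l) l (climb l e k S)"

primrec descend :: "int \<Rightarrow> int \<Rightarrow> nat \<Rightarrow> stacks \<Rightarrow> stacks" where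
  "descend l a 0 S = S"
| "descend l a (Suc k) S = descend l a k (push (a - int k * l) (- l) S)"

lemma leave_climb:
  assumes "leave A S e m S' v" "\<And>i. 1 \<le> i \<Longrightarrow> i \<le> k \<Longrightarrow> e - int i * l \<in> A"
  shows "leave A (climb l e k S) (e - int k * l) (m + k) S' v"
  using assms(2)
proof (induction k)
  case (Suc k)
  have "leave A (climb l e k S) (e - int (Suc k) * l + l) (m + k) S' v"
    using Suc by (simp add: algebra_simps)
  then show ?case unfolding climb.simps add_Suc_right by (intro leave_push Suc.prems) auto
qed (use assms in auto)

lemma leave_descend:
  assumes "leave A S (a - int k * l) m S' v" "\<And>i. i < k \<Longrightarrow> a - int i * l \<in> A"
  shows "leave A (descend l a k S) a (m + k) S' v"
  using assms
proof (induction k arbitrary: S m)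
  case (Suc k)
  have "leave A (push (a - int k * l) (- l) S) (a - int k * l) (Suc m) S' v"
    using Suc.prems by (intro leave_push) (auto simp: algebra_simps)
  then show ?case using Suc.IH[of _ "Suc m"] Suc.prems by auto
qed simp

text \<open>
Each negative site is \<open>s - k l\<close> for a unique \<open>s\<close> in \<open>[-l, -1]\<close>, its class, and a unique \<open>k\<close>, its depth.
\<close>

lemma site_eq_iff:
  fixes l :: int
  assumes "s \<in> {- l..-1}" "s' \<in> {- l..-1}"
  shows "s - int k * l = s' - int k' * l \<longleftrightarrow> s = s' \<and> k = k'"
proof
  assume eq: "s - int k * l = s' - int k' * l"
  have l: "l > 0" using assms by auto
  have "(int k - int k') * l = s - s'" using eq by (simp add: algebra_simps)
  then have "\<bar>int k - int k'\<bar> * l = \<bar>s - s'\<bar>" using l by (metis abs_mult abs_of_pos)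
  moreover have "\<bar>s - s'\<bar> < l" using assms by auto
  ultimately have "\<bar>int k - int k'\<bar> * l < 1 * l" by linarith
  then have "\<bar>int k - int k'\<bar> < 1" using l mult_less_cancel_right_pos by blast
  then have "k = k'" by simp
  then show "s = s' \<and> k = k'" using eq by simp
qed auto

lemma climb_apply:
  assumes "s \<in> {- l..-1}" "e \<in> {- l..-1}"
  shows "climb l e k S (s - int j * l) =
    (if s = e \<and> 1 \<le> j \<and> j \<le> k then case_nat l (S (s - int j * l)) else S (s - int j * l))"
proof (induction k)
  case (Suc k)
  then show ?case unfolding climb.simps push_apply site_eq_iff[OF assms] by auto
qed auto

lemma descend_apply:
  assumes "s \<in> {- l..-1}" "a \<in> {- l..-1}"
  shows "descend l a k S (s - int j * l) =
    (if s = a \<and> j < k then case_nat (- l) (S (s - int j * l)) else S (s - int j * l))"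
proof (induction k arbitrary: S)
  case (Suc k)
  show ?case unfolding descend.simps Suc push_apply site_eq_iff[OF assms] by auto
qed simp

lemma push_range: "(\<And>z j. S z j \<in> R) \<Longrightarrow> c \<in> R \<Longrightarrow> push y c S z j \<in> R"
  by (auto simp: push_apply split: nat.split)

lemma climb_range: "(\<And>z j. S z j \<in> R) \<Longrightarrow> l \<in> R \<Longrightarrow> climb l e k S z j \<in> R"
  by (induction k arbitrary: z j) (auto intro!: push_range simp del: of_nat_Suc)

lemma descend_range: "(\<And>z j. S z j \<in> R) \<Longrightarrow> - l \<in> R \<Longrightarrow> descend l a k S z j \<in> R"
proof (induction k arbitrary: S z j)
  case (Suc k)
  show ?case unfolding descend.simps by (intro Suc.IH push_range Suc.prems)
qed simp

text \<open>
Here \<open>q z\<close> is the number of visits to \<open>z\<close> and \<open>e\<close> is the site from which the walk leaves \<open>A\<close>. If the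
first jump already led out of \<open>A\<close>, then \<open>e\<close> would be the starting point \<open>a\<close>.
\<close>

lemma leave_visits:
  assumes "leave A S a k S' b" "a \<in> A"
  shows "\<exists>e\<in>A. \<exists>q. (\<forall>z j. S' z j = S z (j + q z)) \<and> 1 \<le> q e \<and> b = e + S e (q e - 1) \<and>
    1 \<le> q a \<and> (a \<noteq> e \<longrightarrow> a + S a 0 \<in> A)"
  using assms
proof (induction rule: leave.induct)
  case (move u S k S' v)
  show ?case
  proof (cases "u + S u 0 \<in> A")
    case False
    then have "v = u + S u 0" "S' = pop u S" using move.hyps by (auto elim: leave.cases)
    then show ?thesis using move.hyps
      by (intro bexI[of _ u] exI[of _ "\<lambda>z. if z = u then 1 else 0"]) (auto simp: pop_def)
  next
    case True
    then obtain e q where e: "e \<in> A" "\<forall>z j. S' z j = pop u S z (j + q z)" "1 \<le> q e"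
      "v = e + pop u S e (q e - 1)" using move.IH by blast
    then show ?thesis using move.hyps True
      by (intro bexI[of _ e] exI[of _ "q(u := Suc (q u))"]) (auto simp: pop_def)
  qed
qed simp

text \<open>
The invariant that keeps constructed stacks \<open>g\<close> eventually constant: whenever the given stack \<open>f\<close> is constant
from \<open>N\<close> on, so is \<open>g\<close>, with the value of \<open>f\<close> translated by \<open>h\<close>. By \<open>tracks_push\<close> it survives a backward
step across an excursion in which \<open>f\<close> was used at least once and \<open>g\<close> exactly once, provided that \<open>g\<close>
used the translation of one of the jumps of \<open>f\<close>.
\<close>

definition tracks :: "(int \<Rightarrow> int) \<Rightarrow> (nat \<Rightarrow> int) \<Rightarrow> (nat \<Rightarrow> int) \<Rightarrow> bool" where
  "tracks h f g \<longleftrightarrow> (\<forall>N c. (\<forall>j\<ge>N. f j = c) \<longrightarrow> (\<forall>j\<ge>N. g j = h c))"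

lemma tracks_skip:
  assumes "tracks h f' g" "\<And>j. f' j = f (j + q)"
  shows "tracks h f g"
  unfolding tracks_def
proof (intro allI impI)
  fix N c j assume "\<forall>j\<ge>N. f j = c" "N \<le> j"
  then have "\<forall>j\<ge>N. f' j = c" using assms(2) by simp
  then show "g j = h c" using assms(1) \<open>N \<le> j\<close> unfolding tracks_def by blast
qed

lemma tracks_push:
  assumes "tracks h f' g" "\<And>j. f' j = f (j + q)" "r < q" "x = h (f r)"
  shows "tracks h f (case_nat x g)"
  unfolding tracks_def
proof (intro allI impI)
  fix N c j assume N: "\<forall>j\<ge>N. f j = c" "N \<le> j"
  then have "\<forall>j\<ge>N - 1. f' j = c" using assms(2,3) by simp
  then have *: "\<forall>j\<ge>N - 1. g j = h c" using assms(1) unfolding tracks_def by blast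
  show "case_nat x g j = h c"
    using N * assms(4) by (cases j) auto
qed

text \<open>
A new top cookie of arbitrary value can be afforded where \<open>f\<close> was used: \<open>f\<close> without its used cookies is
constant one step earlier, except that position 0 of the new stack is always taken by that cookie.
\<close>

lemma tracks_push_any:
  assumes "tracks h f' g" "\<And>j. f' j = f (j + q)" "1 \<le> q" "\<forall>j\<ge>N. f j = c" "max N 1 \<le> j"
  shows "case_nat x g j = h c"
proof -
  have "\<forall>j\<ge>N - 1. f' j = c" using assms by simp
  then have *: "\<forall>j\<ge>N - 1. g j = h c" using assms(1) unfolding tracks_def by blast
  show ?thesis using * assms(5) by (cases j) auto
qed

text \<open>
The translations for \<open>tracks\<close> at the class \<open>s\<close>. At depth 0 the jumps that leave the negative sites are kept,
and every other jump becomes the start of a descent. At greater depth, a jump leaving the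
negative sites corresponds to the climb that precedes it.
\<close>

definition exit_jump :: "int \<Rightarrow> int \<Rightarrow> int \<Rightarrow> int" where
  "exit_jump l s c = (if 0 \<le> s + c then c else - l)"

definition channel_jump :: "int \<Rightarrow> int \<Rightarrow> int \<Rightarrow> int" where
  "channel_jump l s c = (if 0 \<le> s + c then l else - l)"

text \<open>
The state of the gadget before the excursion that is assigned the depth \<open>d\<close>. At depths below \<open>d\<close> the site
is passed by all coming excursions and follows the given stack of its class. At depth \<open>d\<close> the
crossing may have put one cookie of arbitrary value on top, and the sites at greater depths are not yet
in use; both are covered by the bound \<open>max N 1\<close>.
\<close>

definition imitates :: "int \<Rightarrow> nat \<Rightarrow> stacks \<Rightarrow> stacks \<Rightarrow> bool" where
  "imitates l d S G \<longleftrightarrow> (\<forall>z j. G z j \<in> {- l..l}) \<and>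
    (\<forall>s\<in>{- l..-1}. tracks (exit_jump l s) (S s) (G s) \<and>
      (\<forall>k. 1 \<le> k \<longrightarrow> k < d \<longrightarrow> tracks (channel_jump l s) (S s) (G (s - int k * l))) \<and>
      (\<forall>k\<ge>d. \<forall>N c. (\<forall>j\<ge>N. S s j = c) \<longrightarrow>
         (\<forall>j\<ge>max N 1. G (s - int k * l) j = channel_jump l s c)))"

lemma imitatesI:
  assumes "\<And>z j. G z j \<in> {- l..l}"
    and "\<And>s. s \<in> {- l..-1} \<Longrightarrow> tracks (exit_jump l s) (S s) (G s)"
    and "\<And>s k. s \<in> {- l..-1} \<Longrightarrow> 1 \<le> k \<Longrightarrow> k < d \<Longrightarrow>
      tracks (channel_jump l s) (S s) (G (s - int k * l))"
    and "\<And>s k N c j. s \<in> {- l..-1} \<Longrightarrow> d \<le> k \<Longrightarrow> \<forall>j\<ge>N. S s j = c \<Longrightarrow> max N 1 \<le> j \<Longrightarrow>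
      G (s - int k * l) j = channel_jump l s c"
  shows "imitates l d S G"
  unfolding imitates_def using assms by (intro conjI ballI allI impI)

lemma imitatesD:
  assumes "imitates l d S G"
  shows "G z j \<in> {- l..l}"
    and "s \<in> {- l..-1} \<Longrightarrow> tracks (exit_jump l s) (S s) (G s)"
    and "s \<in> {- l..-1} \<Longrightarrow> 1 \<le> k \<Longrightarrow> k < d \<Longrightarrow>
      tracks (channel_jump l s) (S s) (G (s - int k * l))"
    and "s \<in> {- l..-1} \<Longrightarrow> d \<le> k \<Longrightarrow> \<forall>j\<ge>N. S s j = c \<Longrightarrow> max N 1 \<le> j \<Longrightarrow>
      G (s - int k * l) j = channel_jump l s c"
  using assms unfolding imitates_def by (elim conjE, simp)+

text \<open>
Backward induction over the list of excursions. The first excursion crosses over at depth \<open>d\<close>, and the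
later ones at greater depths, so that a site at depth \<open>k\<close> is used only from the excursion of depth \<open>k\<close> on.
\<close>

lemma excursion_gadget:
  fixes L :: nat
  defines "l \<equiv> int L"
  assumes "L \<ge> 1" "answers {..<0} S \<tau> n" "set \<tau> \<subseteq> {- l..-1} \<times> {0..}" "\<And>z j. S z j \<in> {- l..l}"
    and "lo \<le> - (int (d + length \<tau>) * l)" "d \<ge> 1"
  shows "\<exists>G T. answers {lo..<0} G \<tau> T \<and> imitates l d S G"
  using assms(3-)
proof (induction \<tau> arbitrary: S n d)
  case Nil
  have l: "l \<ge> 1" using assms by simp
  \<comment> \<open>After the last excursion the gadget follows the given stacks from the start, site by site.\<close>
  define G where "G z j = (let s = - 1 - ((- 1 - z) mod l) in
    if z \<ge> 0 then 0 else if - l \<le> z then exit_jump l s (S s j) else channel_jump l s (S s j))" for z j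
  have s: "- 1 - ((- 1 - (s - int k * l)) mod l) = s" if "s \<in> {- l..-1}" for s k
  proof -
    have "(- 1 - (s - int k * l)) mod l = (- 1 - s + int k * l) mod l" by (simp add: algebra_simps)
    also have "\<dots> = - 1 - s" using that by (simp add: mod_pos_pos_trivial)
    finally show ?thesis by simp
  qed
  have B: "G s = (\<lambda>j. exit_jump l s (S s j))" if "s \<in> {- l..-1}" for s
    using that s[of s 0] by (auto simp: G_def fun_eq_iff)
  have C: "G (s - int k * l) = (\<lambda>j. channel_jump l s (S s j))" if "s \<in> {- l..-1}" "1 \<le> k" for s k
  proof -
    have "1 * l \<le> int k * l" using that l by (intro mult_right_mono) auto
    moreover have "s < 0" using that by auto
    ultimately have "s - int k * l < - l" by linarith
    then show ?thesis using s[OF that(1), of k] l by (auto simp: G_def fun_eq_iff)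
  qed
  have R: "G z j \<in> {- l..l}" for z j
    using Nil.prems(3) l by (auto simp: G_def Let_def exit_jump_def channel_jump_def)
  have 0: "tracks (exit_jump l s) (S s) (G s)" if "s \<in> {- l..-1}" for s
    using B[OF that] by (simp add: tracks_def)
  have 1: "tracks (channel_jump l s) (S s) (G (s - int k * l))" if "s \<in> {- l..-1}" "1 \<le> k" for s k
    using C[OF that] by (simp add: tracks_def)
  have 2: "G (s - int k * l) j = channel_jump l s c"
    if "s \<in> {- l..-1}" "d \<le> k" "\<forall>j\<ge>N. S s j = c" "max N 1 \<le> j" for s k N c j
    using C[OF that(1), of k] that Nil.prems(5) by simp
  have 3: "answers {lo..<0} G [] 0" by simp
  have imitates: "imitates l d S G" by (intro imitatesI R 0 1 2)
  show ?case
    using 3 imitates by blast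
next
  case (Cons ab \<tau>)
  obtain a b where ab: "ab = (a, b)" by force
  have l: "l \<ge> 1" using assms by simp
  have a: "a \<in> {- l..-1}" "b \<ge> 0" using Cons.prems(2) by (auto simp: ab)
  from Cons.prems(1) obtain k S' where k: "leave {..<0} S a k S' b" "answers {..<0} S' \<tau> (n - k)"
    by (auto simp: ab)
  obtain e q where e: "e < 0" "\<And>z j. S' z j = S z (j + q z)" "1 \<le> q e" "b = e + S e (q e - 1)"
    "1 \<le> q a" "a \<noteq> e \<Longrightarrow> a + S a 0 < 0"
    using leave_visits[OF k(1)] a by auto
  have eB: "e \<in> {- l..-1}" using e a Cons.prems(3)[of e "q e - 1"] by auto
  have "\<exists>G T. answers {lo..<0} G \<tau> T \<and> imitates l (Suc d) S' G"
  proof (rule Cons.IH[OF k(2)])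
    show "set \<tau> \<subseteq> {- l..-1} \<times> {0..}" using Cons.prems(2) by auto
    show "S' z j \<in> {- l..l}" for z j unfolding e(2) by (rule Cons.prems(3))
    show "lo \<le> - (int (Suc d + length \<tau>) * l)" using Cons.prems(4) by simp
  qed simp
  then obtain G' T where G'T: "answers {lo..<0} G' \<tau> T" "imitates l (Suc d) S' G'"
    by blast
  note G' = G'T(1) imitatesD[OF G'T(2)]
  have lo: "s - int i * l \<in> {lo..<0}" if "i \<le> d" "s \<in> {- l..-1}" for s i
  proof -
    have "int i * l \<le> int d * l" using that l by simp
    moreover have "int (d + length (ab # \<tau>)) * l = int d * l + l + int (length \<tau>) * l"
      by (simp add: algebra_simps)
    moreover have "0 \<le> int (length \<tau>) * l" "0 \<le> int i * l" using l by auto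
    moreover have "- l \<le> s" "s < 0" using that by auto
    ultimately show ?thesis using Cons.prems(4) unfolding atLeastLessThan_iff by linarith
  qed
  have exitv: "exit_jump l e (S e (q e - 1)) = b - e" "channel_jump l e (S e (q e - 1)) = l"
    using e a by (auto simp: exit_jump_def channel_jump_def)
  have inv: "exit_jump l a (S a 0) = - l" "channel_jump l a (S a 0) = - l" if "a \<noteq> e"
    using e(6)[OF that] by (auto simp: exit_jump_def channel_jump_def)
  have be: "b - e \<in> {- l..l}" using e Cons.prems(3)[of e "q e - 1"] by auto
  have skip: "tracks h (S s) g" if "tracks h (S' s) g" for h s g
    by (rule tracks_skip[OF that e(2)])
  have deep: "G' (s - int k * l) j = channel_jump l s c"
    if "s \<in> {- l..-1}" "k \<ge> Suc d" "\<forall>j\<ge>N. S s j = c" "max N 1 \<le> j" for s k N c j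
    by (rule G'(5)[OF that(1,2) _ that(4)]) (use that e in simp)
  show ?case
  proof (cases "a = e")
    case True
    \<comment> \<open>The excursion starts at its exit site, and a single jump suffices. The given walk may have made a
      detour; treating it as a descent and a climb could let the jumps of its class alternate beyond the \<open>M\<close>th cookie.\<close>
    let ?G = "push e (b - e) G'"
    have "leave {lo..<0} G' (e + (b - e)) 0 G' b" using a by (auto intro!: leave.stop)
    then have "leave {lo..<0} ?G e (Suc 0) G' b"
      using lo[of 0 e] eB by (intro leave_push) auto
    then have ans: "answers {lo..<0} ?G (ab # \<tau>) (Suc T)"
      using G'(1) True by (auto simp: ab intro!: exI[of _ "Suc 0"])
    have G0: "?G s = (if s = e then case_nat (b - e) (G' s) else G' s)" for s
      by (simp add: push_apply)
    have G1: "?G (s - int k * l) = G' (s - int k * l)" if "s \<in> {- l..-1}" "1 \<le> k" for s k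
      using site_eq_iff[OF that(1) eB, of k 0] that by (simp add: push_apply)
    have R: "?G z j \<in> {- l..l}" for z j by (rule push_range[OF G'(2) be])
    have 0: "tracks (exit_jump l s) (S s) (?G s)" if "s \<in> {- l..-1}" for s
    proof (cases "s = e")
      case True
      have "tracks (exit_jump l s) (S s) (case_nat (b - e) (G' s))"
        by (rule tracks_push[OF G'(3)[OF that] e(2), of "q e - 1"]) (use True e(3) exitv in auto)
      then show ?thesis unfolding G0 using True by simp
    qed (use skip[OF G'(3)[OF that]] in \<open>simp add: G0\<close>)
    have 1: "tracks (channel_jump l s) (S s) (?G (s - int k * l))"
      if "s \<in> {- l..-1}" "1 \<le> k" "k < d" for s k
      using skip[OF G'(4)[OF that(1,2)]] that G1 by auto
    have 2: "?G (s - int k * l) j = channel_jump l s c"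
      if "s \<in> {- l..-1}" "d \<le> k" "\<forall>j\<ge>N. S s j = c" "max N 1 \<le> j" for s k N c j
    proof (cases "k = d")
      case True
      then have "tracks (channel_jump l s) (S s) (G' (s - int k * l))"
        using skip[OF G'(4)] that Cons.prems(5) by auto
      then show ?thesis using that Cons.prems(5) unfolding tracks_def by (auto simp: G1)
    qed (use deep that Cons.prems(5) G1 in auto)
    have "imitates l d S ?G" by (intro imitatesI R 0 1 2)
    then show ?thesis using ans by blast
  next
    case False
    \<comment> \<open>The path: down from \<open>a\<close> to depth \<open>d\<close>, across to the class of \<open>e\<close>, up to \<open>e\<close>, and out to \<open>b\<close>.\<close>
    let ?G1 = "climb l e d (push e (b - e) G')"
    let ?G2 = "push (a - int d * l) (e - a) ?G1"
    let ?G = "descend l a d ?G2"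
    have "leave {lo..<0} G' (e + (b - e)) 0 G' b" using a by (auto intro!: leave.stop)
    then have "leave {lo..<0} (push e (b - e) G') e (Suc 0) G' b"
      using lo[of 0 e] eB by (intro leave_push) auto
    then have "leave {lo..<0} ?G1 (e - int d * l) (Suc 0 + d) G' b"
      by (rule leave_climb) (use lo eB in auto)
    then have "leave {lo..<0} ?G2 (a - int d * l) (Suc (Suc 0 + d)) G' b"
      by (intro leave_push lo a) (auto simp: algebra_simps)
    then have "leave {lo..<0} ?G a (Suc (Suc 0 + d) + d) G' b"
      by (rule leave_descend) (use lo a in auto)
    then have ans: "answers {lo..<0} ?G (ab # \<tau>) (T + (Suc (Suc 0 + d) + d))"
      using G'(1) by (auto simp: ab intro!: exI[of _ "Suc (Suc 0 + d) + d"])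
    have pe: "push e x S (s - int k * l) = (if s = e \<and> k = 0 then case_nat x (S (s - int k * l)) else S (s - int k * l))"
      if "s \<in> {- l..-1}" for x S s k
      using site_eq_iff[OF that eB, of k 0] by (simp add: push_apply)
    have G: "?G (s - int k * l) = (if s = a then if k < d then case_nat (- l) (G' (s - int k * l))
         else if k = d then case_nat (e - a) (G' (s - int k * l)) else G' (s - int k * l)
       else if s = e then if k = 0 then case_nat (b - e) (G' s)
         else if k \<le> d then case_nat l (G' (s - int k * l)) else G' (s - int k * l)
       else G' (s - int k * l))" if "s \<in> {- l..-1}" for s k
      unfolding descend_apply[OF that a(1)] push_apply[of "a - int d * l"] site_eq_iff[OF that a(1)]
        climb_apply[OF that eB] pe[OF that]
      using False Cons.prems(5) by auto
    have G0: "?G s = (if s = a then case_nat (- l) (G' s) else if s = e then case_nat (b - e) (G' s)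
       else G' s)" if "s \<in> {- l..-1}" for s
      using G[OF that, of 0] Cons.prems(5) by simp
    have R: "?G z j \<in> {- l..l}" for z j
      by (intro descend_range push_range climb_range G'(2)) (use be a eB l in auto)
    have 0: "tracks (exit_jump l s) (S s) (?G s)" if s: "s \<in> {- l..-1}" for s
    proof -
      consider "s = a" | "s \<noteq> a" "s = e" | "s \<noteq> a" "s \<noteq> e" by blast
      then show ?thesis
      proof cases
        case 1
        have "tracks (exit_jump l s) (S s) (case_nat (- l) (G' s))"
          by (rule tracks_push[OF G'(3)[OF s] e(2), of 0]) (use 1 e inv[OF False] in auto)
        then show ?thesis using 1 s by (simp add: G0)
      next
        case 2
        have "tracks (exit_jump l s) (S s) (case_nat (b - e) (G' s))"
          by (rule tracks_push[OF G'(3)[OF s] e(2), of "q e - 1"]) (use 2 e exitv in auto)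
        then show ?thesis using 2 s by (simp add: G0)
      next
        case 3
        then show ?thesis using s skip[OF G'(3)[OF s]] by (simp add: G0)
      qed
    qed
    have 1: "tracks (channel_jump l s) (S s) (?G (s - int k * l))"
      if s: "s \<in> {- l..-1}" and k: "1 \<le> k" "k < d" for s k
    proof -
      have G'': "tracks (channel_jump l s) (S' s) (G' (s - int k * l))" using G'(4) s k by auto
      consider "s = a" | "s \<noteq> a" "s = e" | "s \<noteq> a" "s \<noteq> e" by blast
      then show ?thesis
      proof cases
        case 1
        have "tracks (channel_jump l s) (S s) (case_nat (- l) (G' (s - int k * l)))"
          by (rule tracks_push[OF G'' e(2), of 0]) (use 1 e inv[OF False] in auto)
        then show ?thesis using 1 s k by (simp add: G)
      next
        case 2
        have "tracks (channel_jump l s) (S s) (case_nat l (G' (s - int k * l)))"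
          by (rule tracks_push[OF G'' e(2), of "q e - 1"]) (use 2 e exitv in auto)
        then show ?thesis using 2 s k by (simp add: G)
      next
        case 3
        then show ?thesis using s skip[OF G''] by (simp add: G)
      qed
    qed
    have 2: "?G (s - int k * l) j = channel_jump l s c"
      if s: "s \<in> {- l..-1}" and k: "d \<le> k" and N: "\<forall>j\<ge>N. S s j = c" "max N 1 \<le> j" for s k N c j
    proof (cases "k = d")
      case True
      have G'': "tracks (channel_jump l s) (S' s) (G' (s - int k * l))"
        using G'(4) s True Cons.prems(5) by auto
      consider "s = a \<or> s = e" | "s \<noteq> a" "s \<noteq> e" by blast
      then show ?thesis
      proof cases
        case 1
        have *: "case_nat x (G' (s - int k * l)) j = channel_jump l s c" for x
          by (rule tracks_push_any[OF G'' e(2) _ N]) (use 1 e in auto)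
        show ?thesis unfolding G[OF s] using 1 True Cons.prems(5) * by auto
      next
        case 2
        then show ?thesis using s N skip[OF G''] unfolding tracks_def G[OF s] by auto
      qed
    next
      case False
      then show ?thesis using deep[OF s _ N, of k] k unfolding G[OF s] by auto
    qed
    have "imitates l d S ?G" by (intro imitatesI R 0 1 2)
    then show ?thesis using ans by blast
  qed
qed

text \<open>
The first passage starts below all excursions and climbs up the class of the site \<open>e\<close> from which the given
walk left the negative sites for the first time. It uses one cookie at each depth. The given walk
has also used a cookie of \<open>e\<close>, so that its stack at \<open>e\<close> is afterwards constant from \<open>M - 2\<close> on; by
\<open>imitates\<close> the sites below are constant from \<open>max (M - 2) 1\<close> on before the first passage is added,
and \<open>M \<ge> 3\<close> yields \<open>M - 1\<close> after it.
\<close>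

lemma leftmost_gadget:
  fixes L M :: nat
  defines "l \<equiv> int L"
  assumes "L \<ge> 1" "M \<ge> 3" "answers {..<0} S ((a, b) # \<tau>) n" "a < 0" "b \<ge> 0"
    and "set \<tau> \<subseteq> {- l..-1} \<times> {0..}"
    and "\<And>z j. S z j \<in> {- l..l}" "\<And>z j. M - 1 \<le> j \<Longrightarrow> S z j = S z (M - 1)"
  shows "\<exists>G p T. p < 0 \<and> answers {p..<0} G ((p, b) # \<tau>) T \<and> (\<forall>z j. G z j \<in> {- l..l}) \<and>
     (\<forall>z j. p \<le> z \<longrightarrow> z < 0 \<longrightarrow> M - 1 \<le> j \<longrightarrow> G z j = G z (M - 1))"
proof -
  have l: "l \<ge> 1" using assms by simp
  from assms(4) obtain k S' where k: "leave {..<0} S a k S' b" "answers {..<0} S' \<tau> (n - k)" by auto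
  obtain e q where e: "e < 0" "\<And>z j. S' z j = S z (j + q z)" "1 \<le> q e" "b = e + S e (q e - 1)"
    using leave_visits[OF k(1)] assms(5) by auto
  have eB: "e \<in> {- l..-1}" using e assms(6) assms(8)[of e "q e - 1"] by auto
  define m where "m = Suc (length \<tau>)"
  define p where "p = e - int m * l"
  have plo: "p \<le> - (int (1 + length \<tau>) * l)" using eB by (simp add: p_def m_def)
  have S'_range: "S' z j \<in> {- int L..int L}" for z j
    using assms(8)[of z "j + q z"] unfolding e(2) l_def .
  have "\<exists>G T. answers {p..<0} G \<tau> T \<and> imitates l 1 S' G"
    unfolding l_def
    by (rule excursion_gadget[OF assms(2) k(2) assms(7)[unfolded l_def] S'_range plo[unfolded l_def] order_refl])
  then obtain G' T where G'T: "answers {p..<0} G' \<tau> T" "imitates l 1 S' G'"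
    by blast
  note G' = G'T(1) imitatesD(1,2,4)[OF G'T(2)]
  let ?G = "climb l e m (push e (b - e) G')"
  have inA: "e - int i * l \<in> {p..<0}" if "i \<le> m" for i
  proof -
    have "int i * l \<le> int m * l" "0 \<le> int i * l" using that l by auto
    moreover have "e < 0" using eB by auto
    ultimately show ?thesis unfolding p_def atLeastLessThan_iff by linarith
  qed
  have "leave {p..<0} G' (e + (b - e)) 0 G' b" using assms(6) by (auto intro!: leave.stop)
  then have "leave {p..<0} (push e (b - e) G') e (Suc 0) G' b"
    using inA[of 0] by (intro leave_push) auto
  then have "leave {p..<0} ?G p (Suc 0 + m) G' b"
    unfolding p_def by (rule leave_climb) (use inA in \<open>auto simp: p_def\<close>)
  then have ans: "answers {p..<0} ?G ((p, b) # \<tau>) (T + (Suc 0 + m))"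
    using G'(1) by (auto intro!: exI[of _ "Suc 0 + m"])
  have be: "b - e \<in> {- l..l}" using e assms(8)[of e "q e - 1"] by auto
  have R: "?G z j \<in> {- l..l}" for z j
    by (intro push_range climb_range G'(2)) (use be l in auto)
  have p: "p < 0" using inA[of m] by (simp add: p_def)
  have stable: "?G z j = ?G z (M - 1)" if z: "z < 0" and j: "M - 1 \<le> j" for z j
  proof -
    define s where "s = - 1 - ((- 1 - z) mod l)"
    define i where "i = nat ((- 1 - z) div l)"
    have s: "s \<in> {- l..-1}" using l pos_mod_bound[of l "- 1 - z"] pos_mod_sign[of l "- 1 - z"]
      unfolding s_def atLeastAtMost_iff by linarith
    have "int i = (- 1 - z) div l" using z l by (simp add: i_def pos_imp_zdiv_nonneg_iff)
    then have zi: "z = s - int i * l" using mult_div_mod_eq[of l "- 1 - z"]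
      by (simp add: s_def algebra_simps)
    have c: "\<forall>j\<ge>M - 1. S s j = S s (M - 1)" using assms(9) by blast
    show ?thesis
    proof (cases "i = 0")
      case True
      then have G: "?G z = (if s = e then case_nat (b - e) (G' s) else G' s)"
        using climb_apply[OF s eB, of m "push e (b - e) G'" 0] zi by (simp add: push_apply)
      have "tracks (exit_jump l s) (S s) (?G z)"
      proof (cases "s = e")
        case True
        have "tracks (exit_jump l s) (S s) (case_nat (b - e) (G' s))"
          by (rule tracks_push[OF G'(3)[OF s] e(2), of "q e - 1"])
            (use True e assms(6) in \<open>auto simp: exit_jump_def\<close>)
        then show ?thesis using True G by simp
      qed (use tracks_skip[OF G'(3)[OF s] e(2)] G in auto)
      then show ?thesis using c j unfolding tracks_def by (metis order_refl)
    next
      case False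
      then have "z \<noteq> e" using site_eq_iff[OF s eB, of i 0] unfolding zi by simp
      have G: "?G z = (if s = e \<and> i \<le> m then case_nat l (G' z) else G' z)"
        using climb_apply[OF s eB, of m "push e (b - e) G'" i, unfolded zi[symmetric]] \<open>z \<noteq> e\<close> False
        by (simp add: push_apply)
      have *: "G' z j = channel_jump l s (S s (M - 1))" if "max (M - 1 - q s) 1 \<le> j" for j
      proof -
        have S': "\<forall>j\<ge>M - 1 - q s. S' s j = S s (M - 1)"
        proof (intro allI impI)
          fix j assume "M - 1 - q s \<le> j"
          then have "M - 1 \<le> j + q s" by simp
          then show "S' s j = S s (M - 1)" unfolding e(2) using c by blast
        qed
        have "1 \<le> i" using False by simp
        from G'(4)[OF s this S' that] show ?thesis by (simp only: zi)
      qed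
      show ?thesis
      proof (cases "s = e \<and> i \<le> m")
        case True
        then have "?G z i = G' z (i - 1)" if "1 \<le> i" for i
          using G that by (simp split: nat.split)
        moreover have "1 \<le> j" "1 \<le> M - 1" using j assms(3) by auto
        moreover have "G' z (j - 1) = G' z (M - 1 - 1)"
        proof -
          have "1 \<le> q s" using True e(3) by simp
          then have "max (M - 1 - q s) 1 \<le> j - 1" "max (M - 1 - q s) 1 \<le> M - 1 - 1"
            using j assms(3) by auto
          then show ?thesis using * by metis
        qed
        ultimately show ?thesis by simp
      next
        case False
        then have "?G z = G' z" using G by auto
        moreover have "max (M - 1 - q s) 1 \<le> j" "max (M - 1 - q s) 1 \<le> M - 1"
          using j assms(3) by auto
        ultimately show ?thesis using * by metis
      qed
    qed
  qed
  show ?thesis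
    by (rule exI[of _ ?G], rule exI[of _ p], rule exI[of _ "T + (Suc 0 + m)"]) (use ans R p stable in blast)
qed

section \<open>The walk and the law of the cookies\<close>

definition stacks :: "environment \<Rightarrow> stacks" where
  "stacks \<omega> z j = \<omega> (j, z)"

text \<open>
The stacks at time \<open>t\<close>; they link the walk, which counts visits, with the runs above.
\<close>

definition remaining :: "environment \<Rightarrow> nat \<Rightarrow> stacks" where
  "remaining \<omega> t z j = \<omega> (j + visits (walk \<omega>) t z, z)"

lemma remaining_0: "remaining \<omega> 0 = stacks \<omega>"
  by (auto simp: remaining_def stacks_def visits_def fun_eq_iff)

lemma visits_Suc: "visits X (Suc t) z = visits X t z + (if X t = z then 1 else 0)"
proof -
  have "{j. j < Suc t \<and> X j = z} = {j. j < t \<and> X j = z} \<union> (if X t = z then {t} else {})"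
    by (auto simp: less_Suc_eq)
  then show ?thesis by (simp add: visits_def)
qed

lemma walk_step: "walk \<omega> (Suc t) = walk \<omega> t + remaining \<omega> t (walk \<omega> t) 0"
  by (simp add: remaining_def)

lemma pop_remaining: "pop (walk \<omega> t) (remaining \<omega> t) = remaining \<omega> (Suc t)"
  by (auto simp: pop_def remaining_def visits_Suc fun_eq_iff)

lemma walk_leaves:
  assumes "\<And>i. i < k \<Longrightarrow> walk \<omega> (t + i) \<in> A" "walk \<omega> (t + k) \<notin> A"
  shows "leave A (remaining \<omega> t) (walk \<omega> t) k (remaining \<omega> (t + k)) (walk \<omega> (t + k))"
  using assms
proof (induction k arbitrary: t)
  case (Suc k)
  have "leave A (remaining \<omega> (Suc t)) (walk \<omega> (Suc t)) k
      (remaining \<omega> (Suc t + k)) (walk \<omega> (Suc t + k))"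
    by (rule Suc.IH) (use Suc.prems(1)[of "Suc i" for i] Suc.prems(2) in auto)
  then show ?case using Suc.prems(1)[of 0]
    by (auto intro!: leave.move simp: pop_remaining walk_step simp del: walk.simps)
qed (auto intro: leave.stop)

lemma walk_exit:
  assumes "walk \<omega> n \<notin> A"
  shows "\<exists>k\<le>n. \<exists>S' v. leave A (stacks \<omega>) 0 k S' v"
proof -
  define k where "k = (LEAST k. walk \<omega> k \<notin> A)"
  have "walk \<omega> k \<notin> A" unfolding k_def by (rule LeastI) (rule assms)
  moreover have "walk \<omega> i \<in> A" if "i < k" for i
    using not_less_Least that unfolding k_def by blast
  moreover have "k \<le> n" unfolding k_def by (rule Least_le) (rule assms)
  ultimately show ?thesis using walk_leaves[of k \<omega> 0 A] by (auto simp: remaining_0)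
qed

lemma leave_walk:
  assumes "leave A (stacks \<omega>) 0 k S' v"
  shows "walk \<omega> k = v"
proof -
  have "v = walk \<omega> (t + k)" if "leave A S u k S' v" "S = remaining \<omega> t" "u = walk \<omega> t" for S u t
    using that
  proof (induction arbitrary: t rule: leave.induct)
    case (move u S k S' v)
    have "v = walk \<omega> (Suc t + k)"
      by (rule move.IH) (simp_all only: move.prems pop_remaining walk_step)
    then show ?case by simp
  qed simp
  from this[OF assms, of 0] show ?thesis by (simp add: remaining_0)
qed

lemma walk_stuck:
  assumes "walk \<omega> k = q" "\<And>j. \<omega> (j, q) = 0" "k \<le> n"
  shows "walk \<omega> n = q"
  using assms(3) by (induction n rule: dec_induct) (use assms in auto)

definition shift :: "int \<Rightarrow> environment \<Rightarrow> environment" where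
  "shift d \<omega> = (\<lambda>(j, z). \<omega> (j, z + d))"

lemma stacks_shift: "stacks (shift d \<omega>) = (\<lambda>z. stacks \<omega> (z + d))"
  by (auto simp: shift_def stacks_def fun_eq_iff)

lemma environments_range: "\<omega> \<in> environments L M \<Longrightarrow> \<omega> i \<in> {- int L..int L}"
  unfolding environments_def by (cases i) blast

lemma environments_stable: "\<omega> \<in> environments L M \<Longrightarrow> M - 1 \<le> j \<Longrightarrow> \<omega> (j, z) = \<omega> (M - 1, z)"
  unfolding environments_def by blast

lemma shift_in_environments:
  assumes "\<omega> \<in> environments L M"
  shows "shift d \<omega> \<in> environments L M"
  unfolding environments_def shift_def mem_Collect_eq prod.case
  using environments_range[OF assms] environments_stable[OF assms] by blast

text \<open>
Events that depend on finitely many sites are measurable, and independence and shift invariance are needed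
for them only.
\<close>

definition depends_on :: "nat \<Rightarrow> nat \<Rightarrow> int set \<Rightarrow> (environment \<Rightarrow> bool) \<Rightarrow> bool" where
  "depends_on L M F E \<longleftrightarrow> (\<forall>\<omega>\<in>environments L M. \<forall>\<omega>'\<in>environments L M.
     (\<forall>z\<in>F. stacks \<omega> z = stacks \<omega>' z) \<longrightarrow> E \<omega> = E \<omega>')"

lemma depends_onD:
  assumes "depends_on L M F E" "\<omega> \<in> environments L M" "\<omega>' \<in> environments L M"
    "\<And>z. z \<in> F \<Longrightarrow> stacks \<omega> z = stacks \<omega>' z"
  shows "E \<omega> = E \<omega>'"
  using assms unfolding depends_on_def by blast

lemma depends_on_conj:
  "depends_on L M F E \<Longrightarrow> depends_on L M F' E' \<Longrightarrow> depends_on L M (F \<union> F') (\<lambda>\<omega>. E \<omega> \<and> E' \<omega>)"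
  unfolding depends_on_def by (metis UnCI)

lemma depends_on_shift:
  assumes "depends_on L M F E"
  shows "depends_on L M ((\<lambda>z. z + d) ` F) (\<lambda>\<omega>. E (shift d \<omega>))"
  unfolding depends_on_def
proof (intro ballI impI)
  fix \<omega> \<omega>' assume *: "\<omega> \<in> environments L M" "\<omega>' \<in> environments L M"
    "\<forall>z\<in>(\<lambda>z. z + d) ` F. stacks \<omega> z = stacks \<omega>' z"
  show "E (shift d \<omega>) = E (shift d \<omega>')"
    by (rule depends_onD[OF assms]) (use * in \<open>auto simp: stacks_shift shift_in_environments\<close>)
qed

text \<open>
An environment that agrees with \<open>f\<close> on \<open>F\<close>; the cookies with index \<open>M\<close> and above repeat the one with index
\<open>M - 1\<close>, as in every environment.
\<close>

definition extend :: "nat \<Rightarrow> int set \<Rightarrow> environment \<Rightarrow> environment" where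
  "extend M F f = (\<lambda>(j, z). if z \<in> F then f (min j (M - 1), z) else 0)"

locale excited_walk =
  fixes L M :: nat and \<mu> :: "int pmf" and P :: "environment measure"
  assumes L: "L \<ge> 1" and M: "M \<ge> 3" and supp: "set_pmf \<mu> = {- int L..int L}"
    and iid: "iid_cookie_measure L M \<mu> P"
begin

sublocale prob_space P
  using iid unfolding iid_cookie_measure_def by simp

lemma space_P: "space P = environments L M"
  using iid unfolding iid_cookie_measure_def by simp

definition pr :: "(environment \<Rightarrow> bool) \<Rightarrow> real" where
  "pr E = measure P {\<omega> \<in> space P. E \<omega>}"

abbreviation window :: "int set \<Rightarrow> (nat \<times> int) set" where
  "window F \<equiv> {..<M} \<times> F"

abbreviation law :: "int set \<Rightarrow> environment pmf" where
  "law F \<equiv> Pi_pmf (window F) 0 (\<lambda>_. \<mu>)"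

lemma cylinder:
  assumes "finite F"
  shows "{\<omega> \<in> space P. \<forall>i\<in>window F. \<omega> i = f i} \<in> sets P"
    and "measure P {\<omega> \<in> space P. \<forall>i\<in>window F. \<omega> i = f i} = (\<Prod>i\<in>window F. pmf \<mu> (f i))"
proof -
  have fin: "finite (window F)" and sub: "window F \<subseteq> cookie_sites M"
    using assms by (auto simp: cookie_sites_def)
  have indep: "indep_vars (\<lambda>_. count_space UNIV) (\<lambda>i \<omega>. \<omega> i) (cookie_sites M)"
    and distr: "\<And>i. i \<in> cookie_sites M \<Longrightarrow> distr P (count_space UNIV) (\<lambda>\<omega>. \<omega> i) = measure_pmf \<mu>"
    using iid unfolding iid_cookie_measure_def by auto
  have meas: "(\<lambda>\<omega>. \<omega> i) \<in> measurable P (count_space UNIV)" if "i \<in> cookie_sites M" for i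
    using indep that unfolding indep_vars_def by auto
  have single: "(\<lambda>\<omega>. \<omega> i) -` {f i} \<inter> space P \<in> sets P"
    "measure P ((\<lambda>\<omega>. \<omega> i) -` {f i} \<inter> space P) = pmf \<mu> (f i)" if "i \<in> window F" for i
  proof -
    have i: "i \<in> cookie_sites M" using that sub by auto
    show "(\<lambda>\<omega>. \<omega> i) -` {f i} \<inter> space P \<in> sets P" by (rule measurable_sets[OF meas[OF i]]) simp
    have "measure P ((\<lambda>\<omega>. \<omega> i) -` {f i} \<inter> space P) = measure (distr P (count_space UNIV) (\<lambda>\<omega>. \<omega> i)) {f i}"
      by (rule measure_distr[symmetric, OF meas[OF i]]) simp
    then show "measure P ((\<lambda>\<omega>. \<omega> i) -` {f i} \<inter> space P) = pmf \<mu> (f i)"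
      by (simp add: distr[OF i] measure_pmf_single)
  qed
  show "{\<omega> \<in> space P. \<forall>i\<in>window F. \<omega> i = f i} \<in> sets P"
  proof (cases "window F = {}")
    case False
    have "{\<omega> \<in> space P. \<forall>i\<in>window F. \<omega> i = f i} = (\<Inter>i\<in>window F. (\<lambda>\<omega>. \<omega> i) -` {f i} \<inter> space P)"
      using False by auto
    then show ?thesis using fin False single(1) by (simp only:) (intro sets.finite_INT, auto)
  qed (use M in auto)
  show "measure P {\<omega> \<in> space P. \<forall>i\<in>window F. \<omega> i = f i} = (\<Prod>i\<in>window F. pmf \<mu> (f i))"
  proof (cases "window F = {}")
    case True
    then show ?thesis using prob_space by auto
  next
    case False
    have "{\<omega> \<in> space P. \<forall>i\<in>window F. \<omega> i = f i} = (\<Inter>i\<in>window F. (\<lambda>\<omega>. \<omega> i) -` {f i} \<inter> space P)"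
      using False by auto
    also have "measure P \<dots> = (\<Prod>i\<in>window F. measure P ((\<lambda>\<omega>. \<omega> i) -` {f i} \<inter> space P))"
      by (rule indep_varsD[OF indep False fin sub]) auto
    also have "\<dots> = (\<Prod>i\<in>window F. pmf \<mu> (f i))" using single(2) by (intro prod.cong) auto
    finally show ?thesis .
  qed
qed

lemma extend_in_environments:
  assumes "\<And>i. i \<in> window F \<Longrightarrow> f i \<in> {- int L..int L}"
  shows "extend M F f \<in> environments L M"
proof -
  have "extend M F f (j, z) \<in> {- int L..int L}" for j z
    using assms[of "(min j (M - 1), z)"] M by (auto simp: extend_def)
  then show ?thesis by (simp add: environments_def extend_def)
qed

lemma set_law: "finite F \<Longrightarrow> set_pmf (law F) = PiE_dflt (window F) 0 (\<lambda>_. {- int L..int L})"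
  by (subst set_Pi_pmf) (auto simp: supp comp_def)

lemma finite_set_law: "finite F \<Longrightarrow> finite (set_pmf (law F))"
  unfolding set_law by (rule finite_PiE_dflt) auto

lemma law_extend_in_environments: "finite F \<Longrightarrow> f \<in> set_pmf (law F) \<Longrightarrow> extend M F f \<in> environments L M"
  unfolding set_law by (intro extend_in_environments) (auto simp: PiE_dflt_def)

text \<open>
Reduction to a finite product: the event is a finite disjoint union of cylinders, so its probability can be
computed under \<open>law F\<close>, where products and reindexing are available.
\<close>

lemma finite_dependence:
  assumes F: "finite F" and E: "depends_on L M F E"
  shows "{\<omega> \<in> space P. E \<omega>} \<in> sets P"
    and "pr E = measure_pmf.prob (law F) {f. E (extend M F f)}"
proof -
  define W where "W = {f \<in> set_pmf (law F). E (extend M F f)}"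
  define C where "C f = {\<omega> \<in> space P. \<forall>i\<in>window F. \<omega> i = f i}" for f :: environment
  have fin: "finite W" unfolding W_def using finite_set_law[OF F] by simp
  have rep: "E \<omega> = E (extend M F f)" if \<omega>: "\<omega> \<in> C f" and f: "f \<in> set_pmf (law F)" for \<omega> f
  proof (rule depends_onD[OF E])
    show env: "\<omega> \<in> environments L M" using \<omega> by (simp add: C_def space_P)
    show "extend M F f \<in> environments L M" by (rule law_extend_in_environments[OF F f])
    fix z assume z: "z \<in> F"
    show "stacks \<omega> z = stacks (extend M F f) z"
    proof
      fix j
      have "\<omega> (j, z) = \<omega> (min j (M - 1), z)"
        using environments_stable[OF env, of j z] by (cases "j \<le> M - 1") (simp_all add: min_def)
      also have "\<dots> = f (min j (M - 1), z)" using \<omega> z M by (simp add: C_def)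
      finally show "stacks \<omega> z j = stacks (extend M F f) z j"
        using z by (simp add: stacks_def extend_def)
    qed
  qed
  have eq: "{\<omega> \<in> space P. E \<omega>} = (\<Union>f\<in>W. C f)"
  proof (intro equalityI subsetI)
    fix \<omega> assume \<omega>: "\<omega> \<in> {\<omega> \<in> space P. E \<omega>}"
    let ?f = "\<lambda>i. if i \<in> window F then \<omega> i else 0"
    have "\<omega> i \<in> {- int L..int L}" for i
      by (rule environments_range[of _ L M]) (use \<omega> in \<open>simp add: space_P\<close>)
    then have f: "?f \<in> set_pmf (law F)" unfolding set_law[OF F] by (auto simp: PiE_dflt_def)
    have "\<omega> \<in> C ?f" using \<omega> by (auto simp: C_def)
    then show "\<omega> \<in> (\<Union>f\<in>W. C f)" using rep[OF _ f] \<omega> f unfolding W_def by blast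
  next
    fix \<omega> assume "\<omega> \<in> (\<Union>f\<in>W. C f)"
    then show "\<omega> \<in> {\<omega> \<in> space P. E \<omega>}" using rep by (auto simp: W_def C_def)
  qed
  have C: "C f \<in> sets P" "measure P (C f) = (\<Prod>i\<in>window F. pmf \<mu> (f i))" for f
    unfolding C_def using cylinder[OF F] by auto
  show "{\<omega> \<in> space P. E \<omega>} \<in> sets P" unfolding eq using fin C by auto
  have disj: "disjoint_family_on C W"
    unfolding disjoint_family_on_def
  proof (intro ballI impI)
    fix f g assume fg: "f \<in> W" "g \<in> W" "f \<noteq> g"
    then obtain i where i: "f i \<noteq> g i" unfolding fun_eq_iff by blast
    have "h i = 0" if "h \<in> W" "i \<notin> window F" for h
      using that unfolding W_def set_law[OF F] PiE_dflt_def by blast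
    then have "i \<in> window F" using fg i by metis
    then show "C f \<inter> C g = {}" using i unfolding C_def by fastforce
  qed
  have "pr E = (\<Sum>f\<in>W. measure P (C f))"
    unfolding pr_def eq by (rule finite_measure_finite_Union[OF fin _ disj]) (use C in auto)
  also have "\<dots> = (\<Sum>f\<in>W. pmf (law F) f)"
  proof (rule sum.cong[OF refl])
    fix f assume "f \<in> W"
    then have "\<And>i. i \<notin> window F \<Longrightarrow> f i = 0" unfolding W_def set_law[OF F] by (auto simp: PiE_dflt_def)
    then show "measure P (C f) = pmf (law F) f" using F by (subst pmf_Pi') (auto simp: C)
  qed
  also have "\<dots> = measure_pmf.prob (law F) W" by (rule measure_measure_pmf_finite[OF fin, symmetric])
  also have "\<dots> = measure_pmf.prob (law F) {f. E (extend M F f)}"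
    unfolding W_def by (rule measure_eq_AE) (auto simp: AE_measure_pmf_iff)
  finally show "pr E = measure_pmf.prob (law F) {f. E (extend M F f)}" .
qed

lemma pr_independent:
  assumes F: "finite F" "depends_on L M F E" and G: "finite G" "depends_on L M G E'" and disj: "F \<inter> G = {}"
  shows "pr (\<lambda>\<omega>. E \<omega> \<and> E' \<omega>) = pr E * pr E'"
proof -
  let ?h = "\<lambda>(f, g) x. if x \<in> window F then f x else g x :: int"
  have "law (F \<union> G) = Pi_pmf (window F \<union> window G) 0 (\<lambda>_. \<mu>)" by (simp add: Sigma_Un_distrib2)
  also have "\<dots> = map_pmf ?h (pair_pmf (law F) (law G))"
    by (rule Pi_pmf_union) (use F G disj in auto)
  finally have law: "law (F \<union> G) = map_pmf ?h (pair_pmf (law F) (law G))" .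
  define U where "U = {f \<in> set_pmf (law F). E (extend M F f)}"
  define V where "V = {g \<in> set_pmf (law G). E' (extend M G g)}"
  have fin: "finite U" "finite V"
    unfolding U_def V_def using finite_set_law F G by simp_all
  have eqs: "(E (extend M (F \<union> G) (?h (f, g))) \<and> E' (extend M (F \<union> G) (?h (f, g)))) =
      (E (extend M F f) \<and> E' (extend M G g))"
    if f: "f \<in> set_pmf (law F)" and g: "g \<in> set_pmf (law G)" for f g
  proof -
    have "?h (f, g) \<in> set_pmf (law (F \<union> G))" unfolding law using f g by auto
    then have env: "extend M (F \<union> G) (?h (f, g)) \<in> environments L M"
      using F G by (intro law_extend_in_environments) auto
    have "E (extend M (F \<union> G) (?h (f, g))) = E (extend M F f)"
      by (rule depends_onD[OF F(2) env law_extend_in_environments[OF F(1) f]])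
        (use M in \<open>auto simp: stacks_def extend_def fun_eq_iff\<close>)
    moreover have "E' (extend M (F \<union> G) (?h (f, g))) = E' (extend M G g)"
      by (rule depends_onD[OF G(2) env law_extend_in_environments[OF G(1) g]])
        (use M disj in \<open>auto simp: stacks_def extend_def fun_eq_iff\<close>)
    ultimately show ?thesis by simp
  qed
  have "pr (\<lambda>\<omega>. E \<omega> \<and> E' \<omega>) =
      measure_pmf.prob (law (F \<union> G)) {f. E (extend M (F \<union> G) f) \<and> E' (extend M (F \<union> G) f)}"
    by (rule finite_dependence) (use F G depends_on_conj in auto)
  also have "\<dots> = measure_pmf.prob (pair_pmf (law F) (law G))
      (?h -` {f. E (extend M (F \<union> G) f) \<and> E' (extend M (F \<union> G) f)})"
    unfolding law by (rule measure_map_pmf)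
  also have "\<dots> = measure_pmf.prob (pair_pmf (law F) (law G)) (U \<times> V)"
    by (rule measure_eq_AE) (use eqs in \<open>auto simp: AE_measure_pmf_iff U_def V_def\<close>)
  also have "\<dots> = measure_pmf.prob (law F) U * measure_pmf.prob (law G) V"
    by (rule measure_pmf_prob_product) (use fin in \<open>auto intro: countable_finite\<close>)
  also have "measure_pmf.prob (law F) U = pr E"
    unfolding finite_dependence(2)[OF F] U_def by (rule measure_eq_AE) (auto simp: AE_measure_pmf_iff)
  also have "measure_pmf.prob (law G) V = pr E'"
    unfolding finite_dependence(2)[OF G] V_def by (rule measure_eq_AE) (auto simp: AE_measure_pmf_iff)
  finally show ?thesis .
qed

lemma pr_shift:
  assumes F: "finite F" "depends_on L M F E"
  shows "pr (\<lambda>\<omega>. E (shift d \<omega>)) = pr E"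
proof -
  let ?F = "(\<lambda>z. z + d) ` F" and ?h = "\<lambda>(j :: nat, z). (j, z + d)"
  have law: "law F = map_pmf (\<lambda>g. g \<circ> ?h) (law ?F)"
  proof (rule Pi_pmf_bij_betw)
    show "bij_betw ?h (window F) (window ?F)"
      by (rule bij_betwI[where g = "\<lambda>(j, z). (j, z - d)"]) auto
  qed (use F in auto)
  have ext: "extend M F (f \<circ> ?h) = shift d (extend M ?F f)" for f
    by (auto simp: extend_def shift_def fun_eq_iff)
  have "pr E = measure_pmf.prob (law F) {f. E (extend M F f)}"
    by (rule finite_dependence[OF F])
  also have "\<dots> = measure_pmf.prob (law ?F) {f. E (shift d (extend M ?F f))}"
    unfolding law by (simp add: vimage_def ext)
  also have "\<dots> = pr (\<lambda>\<omega>. E (shift d \<omega>))"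
    by (rule finite_dependence(2)[symmetric]) (use F depends_on_shift in auto)
  finally show ?thesis by simp
qed

lemma pr_cylinder_pos:
  assumes F: "finite F" and G: "\<And>z j. G z j \<in> {- int L..int L}"
    and st: "\<And>z j. z \<in> F \<Longrightarrow> M - 1 \<le> j \<Longrightarrow> G z j = G z (M - 1)"
  shows "pr (\<lambda>\<omega>. \<forall>z\<in>F. stacks \<omega> z = G z) > 0"
proof -
  let ?f = "\<lambda>(j, z). G z j"
  have "(\<forall>z\<in>F. stacks \<omega> z = G z) \<longleftrightarrow> (\<forall>i\<in>window F. \<omega> i = ?f i)" if \<omega>: "\<omega> \<in> space P" for \<omega>
  proof
    assume eq: "\<forall>z\<in>F. stacks \<omega> z = G z"
    show "\<forall>i\<in>window F. \<omega> i = ?f i"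
    proof
      fix i assume "i \<in> window F"
      then have "stacks \<omega> (snd i) = G (snd i)" using eq by auto
      from fun_cong[OF this, of "fst i"] show "\<omega> i = ?f i" by (simp add: stacks_def case_prod_beta)
    qed
  next
    assume eq: "\<forall>i\<in>window F. \<omega> i = ?f i"
    show "\<forall>z\<in>F. stacks \<omega> z = G z"
    proof (intro ballI ext)
      fix z j assume z: "z \<in> F"
      have below: "\<omega> (i, z) = G z i" if "i < M" for i using eq that z by auto
      show "stacks \<omega> z j = G z j"
      proof (cases "j < M")
        case False
        then have j: "M - 1 \<le> j" by simp
        have "\<omega> (j, z) = \<omega> (M - 1, z)" using \<omega> j by (intro environments_stable[of \<omega> L M]) (simp_all add: space_P)
        also have "\<dots> = G z (M - 1)" by (rule below) (use M in simp)
        also have "\<dots> = G z j" by (rule st[OF z j, symmetric])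
        finally show ?thesis by (simp add: stacks_def)
      qed (simp add: stacks_def below)
    qed
  qed
  then have "{\<omega> \<in> space P. \<forall>z\<in>F. stacks \<omega> z = G z} = {\<omega> \<in> space P. \<forall>i\<in>window F. \<omega> i = ?f i}"
    by blast
  then have "pr (\<lambda>\<omega>. \<forall>z\<in>F. stacks \<omega> z = G z) = (\<Prod>i\<in>window F. pmf \<mu> (?f i))"
    unfolding pr_def using cylinder(2)[OF F, of ?f] by simp
  also have "\<dots> > 0"
    using G supp by (intro prod_pos) (auto simp: pmf_positive)
  finally show ?thesis .
qed

lemma pr_mono:
  assumes "finite F" "depends_on L M F E'" "\<And>\<omega>. \<omega> \<in> environments L M \<Longrightarrow> E \<omega> \<Longrightarrow> E' \<omega>"
  shows "pr E \<le> pr E'"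
  unfolding pr_def
  by (rule finite_measure_mono) (use assms finite_dependence(1)[OF assms(1,2)] in \<open>auto simp: space_P\<close>)

end

section \<open>Estimates for the probability of a straight advance\<close>

text \<open>
The event \<open>advance x n\<close> only depends on the sites in \<open>[0, x)\<close>, and so does the place \<open>v\<close> where this
interval is left.
\<close>

definition exits :: "int set \<Rightarrow> nat \<Rightarrow> int \<Rightarrow> environment \<Rightarrow> bool" where
  "exits A n v \<omega> \<longleftrightarrow> (\<exists>k\<le>n. \<exists>S'. leave A (stacks \<omega>) 0 k S' v)"

definition advance :: "int \<Rightarrow> nat \<Rightarrow> environment \<Rightarrow> bool" where
  "advance x n \<omega> \<longleftrightarrow> (\<exists>v\<ge>x. exits {0..<x} n v \<omega>)"

definition right_part :: "int \<Rightarrow> int \<Rightarrow> (int \<times> int) list \<Rightarrow> nat \<Rightarrow> environment \<Rightarrow> bool" where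
  "right_part y b \<tau> n \<omega> \<longleftrightarrow> (\<exists>z\<ge>y. answers {0..<y} (stacks \<omega>) (chain b \<tau> z) n)"

lemma leave_cong:
  assumes "\<And>z. z \<in> A \<Longrightarrow> R z = S z"
  shows "(\<exists>S'. leave A R u k S' v) \<longleftrightarrow> (\<exists>S'. leave A S u k S' v)"
  using leave_local[of A S u k _ v R] leave_local[of A R u k _ v S] assms by metis

lemma exits_depends: "depends_on L M A (exits A n v)"
  unfolding depends_on_def exits_def
proof (intro ballI impI)
  fix \<omega> \<omega>' assume "\<forall>z\<in>A. stacks \<omega> z = stacks \<omega>' z"
  then have "(\<exists>S'. leave A (stacks \<omega>) 0 k S' v) \<longleftrightarrow> (\<exists>S'. leave A (stacks \<omega>') 0 k S' v)" for k
    by (intro leave_cong) auto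
  then show "(\<exists>k\<le>n. \<exists>S'. leave A (stacks \<omega>) 0 k S' v) = (\<exists>k\<le>n. \<exists>S'. leave A (stacks \<omega>') 0 k S' v)"
    by simp
qed

lemma advance_depends: "depends_on L M {0..<x} (advance x n)"
  using exits_depends[of L M "{0..<x}" n] unfolding depends_on_def advance_def by blast

lemma right_part_depends: "depends_on L M {0..<y} (right_part y b \<tau> n)"
  unfolding depends_on_def right_part_def
  using answers_local[of "{0..<y}" "stacks \<omega>" _ n "stacks \<omega>'" for \<omega> \<omega>'] by metis

lemma advance_mono:
  assumes "advance x n \<omega>" "y \<le> x" "n \<le> m"
  shows "advance y m \<omega>"
proof -
  from assms(1) obtain v k S' where v: "x \<le> v" "k \<le> n" "leave {0..<x} (stacks \<omega>) 0 k S' v"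
    unfolding advance_def exits_def by blast
  obtain j S'' w where w: "j \<le> k" "leave {0..<y} (stacks \<omega>) 0 j S'' w" "w \<in> insert v {0..<x}"
    using leave_subset[OF v(3), of "{0..<y}"] assms(2) by auto
  have "y \<le> w" using leave_notin[OF w(2)] w(3) v(1) assms(2) by auto
  moreover have "j \<le> m" using w v assms by simp
  ultimately show ?thesis using w(2) unfolding advance_def exits_def by blast
qed

lemma advance_trivial: "x \<le> 0 \<Longrightarrow> advance x n \<omega>"
  unfolding advance_def exits_def by (intro exI[of _ 0]) (auto intro!: exI[of _ 0] leave.stop)

lemma leave_overshoot:
  assumes "leave A S u k S' v" "A \<subseteq> {..<x}" "u \<le> x + l" "\<And>z j. S z j \<le> l"
  shows "v \<le> x + l"
  using assms
proof (induction rule: leave.induct)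
  case (move u S k S' v)
  have "u < x" using move.hyps move.prems by auto
  then have "u + S u 0 \<le> x + l" using move.prems(3)[of u 0] by linarith
  then show ?case by (rule move.IH[OF move.prems(1)]) (use move.prems in \<open>auto simp: pop_def\<close>)
qed

lemma leave_speed:
  assumes "leave A S u k S' v" "\<And>z j. S z j \<le> l"
  shows "v \<le> u + l * int k"
  using assms
proof (induction rule: leave.induct)
  case (move u S k S' v)
  have "v \<le> u + S u 0 + l * int k" by (rule move.IH) (use move.prems in \<open>auto simp: pop_def\<close>)
  then show ?case using move.prems[of u 0] by (simp add: algebra_simps)
qed simp

text \<open>
A run that covers the largest possible distance jumps by \<open>l\<close> each time and never turns back.
\<close>

lemma leave_full_speed:
  assumes "leave {..<x} S u k S' v" "\<And>z j. S z j \<le> l" "u + l * int k \<le> v" "0 \<le> l"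
  shows "leave {u..<x} S u k S' v"
  using assms
proof (induction rule: leave.induct)
  case (stop u S)
  then show ?case by (intro leave.stop) auto
next
  case (move u S k S' v)
  have p: "pop u S z j \<le> l" for z j using move.prems by (auto simp: pop_def)
  have "v \<le> u + S u 0 + l * int k" by (rule leave_speed[OF move.hyps(2) p])
  moreover have e: "u + l * int (Suc k) = u + l + l * int k" by (simp add: algebra_simps)
  ultimately have s: "S u 0 = l" using move.prems(1)[of u 0] move.prems(2) by linarith
  have "leave {u + S u 0..<x} (pop u S) (u + S u 0) k S' v"
    by (rule move.IH) (use p s e move.prems in auto)
  then have "leave {u..<x} (pop u S) (u + S u 0) k S' v"
    by (rule leave_mono) (use s move.prems leave_notin[OF move.hyps(2)] in auto)
  then show ?case using move.hyps(1) by (intro leave.move) auto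
qed

text \<open>
At the time the walk leaves \<open>[0, x)\<close> to the right, at \<open>q\<close>, all stacks at and above \<open>q\<close> are untouched, and the
walk seen from \<open>q\<close> continues in the shifted environment.
\<close>

lemma advance_glue:
  assumes q: "0 \<le> x" "x \<le> q" "exits {0..<x} n q \<omega>" and y: "advance y m (shift q \<omega>)"
  shows "advance (q + y) (n + m) \<omega>"
proof (cases "0 \<le> y")
  case True
  from q obtain k S1 where 1: "k \<le> n" "leave {0..<x} (stacks \<omega>) 0 k S1 q"
    unfolding exits_def by blast
  from y obtain v k' S2 where 2: "y \<le> v" "k' \<le> m" "leave {0..<y} (\<lambda>z. stacks \<omega> (z + q)) 0 k' S2 v"
    unfolding advance_def exits_def stacks_shift by blast
  have "(\<lambda>z. z - - q) ` {0..<y} = {q..<q + y}"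
    by (auto simp: image_iff intro!: bexI[of _ "_ - q"])
  then have "leave {q..<q + y} (stacks \<omega>) q k' (\<lambda>z. S2 (z - q)) (v + q)"
    using leave_translate[OF 2(3), of "- q"] by simp
  from leave_local[OF this, of S1] obtain S3 where "leave {q..<q + y} S1 q k' S3 (v + q)"
    using leave_outside[OF 1(2)] q by auto
  from leave_mono[OF this, of "{0..<q + y}"] have "leave {0..<q + y} S1 q k' S3 (v + q)"
    using q 2(1) by auto
  from leave_trans[OF 1(2) this] have "leave {0..<q + y} (stacks \<omega>) 0 (k + k') S3 (v + q)"
    using q True by auto
  moreover have "q + y \<le> v + q" "k + k' \<le> n + m" using 1 2 by auto
  ultimately show ?thesis unfolding advance_def exits_def by blast
next
  case False
  have "advance q (n + m) \<omega>"
  proof (rule advance_mono)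
    from q(3) obtain k S1 where 1: "k \<le> n" "leave {0..<x} (stacks \<omega>) 0 k S1 q"
      unfolding exits_def by blast
    from leave_mono[OF 1(2), of "{0..<q}"] have "leave {0..<q} (stacks \<omega>) 0 k S1 q"
      using q by auto
    then show "advance q n \<omega>" using 1(1) unfolding advance_def exits_def by blast
  qed auto
  then show ?thesis by (rule advance_mono) (use False in auto)
qed

text \<open>
The lists of excursions that occur in some environment. A list of arbitrary pairs need not occur, because each
site has only finitely many different cookies.
\<close>

definition realizable :: "nat \<Rightarrow> nat \<Rightarrow> int \<Rightarrow> (int \<times> int) list \<Rightarrow> bool" where
  "realizable L M b \<tau> \<longleftrightarrow>
     (\<exists>\<omega>\<in>environments L M. \<exists>a<0. \<exists>n. answers {..<0} (stacks \<omega>) ((a, b) # \<tau>) n)"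

definition patterns :: "nat \<Rightarrow> nat \<Rightarrow> nat \<Rightarrow> (int \<times> (int \<times> int) list) set" where
  "patterns L M K = {(b, \<tau>). b \<in> {0..<int L} \<and> set \<tau> \<subseteq> {- int L..-1} \<times> {0..<int L} \<and>
     length \<tau> \<le> K \<and> realizable L M b \<tau>}"

lemma finite_patterns: "finite (patterns L M K)"
proof (rule finite_subset)
  show "patterns L M K \<subseteq> {0..<int L} \<times> {\<tau>. set \<tau> \<subseteq> {- int L..-1} \<times> {0..<int L} \<and> length \<tau> \<le> K}"
    by (auto simp: patterns_def)
qed (intro finite_cartesian_product finite_lists_length_le; simp)

text \<open>
By the pigeonhole principle one of the levels \<open>1, \<dots>, \<Delta>\<close> is crossed upwards at most \<open>K\<close> times. This level is
made the origin.
\<close>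

lemma few_crossings:
  assumes \<omega>: "\<omega> \<in> environments L M" and w: "x \<le> walk \<omega> n"
    and \<Delta>: "int \<Delta> \<le> x" "L * n < \<Delta> * (K + 1)"
  shows "\<exists>d\<in>{1..int \<Delta>}. \<exists>(b, \<tau>)\<in>patterns L M K. right_part (x - d) b \<tau> n (shift d \<omega>)"
proof -
  have range: "stacks \<omega> z j \<in> {- int L..int L}" for z j
    unfolding stacks_def by (rule environments_range[OF \<omega>])
  obtain k S' v where k: "k \<le> n" "leave {..<x} (stacks \<omega>) 0 k S' v"
    using walk_exit[of \<omega> n "{..<x}"] w by auto
  have v: "x \<le> v" using leave_notin[OF k(2)] by simp
  have "\<exists>d\<in>{1..int \<Delta>}. upcrossings d (stacks \<omega>) 0 k \<le> K"
  proof (rule ccontr)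
    assume "\<not> ?thesis"
    then have "(\<Sum>d\<in>{1..int \<Delta>}. K + 1) \<le> (\<Sum>d\<in>{1..int \<Delta>}. upcrossings d (stacks \<omega>) 0 k)"
      by (intro sum_mono) force
    also have "\<dots> \<le> L * k" by (rule sum_upcrossings) (use range in auto)
    also have "\<dots> \<le> L * n" using k by simp
    finally show False using \<Delta> by simp
  qed
  then obtain d where d: "d \<in> {1..int \<Delta>}" "upcrossings d (stacks \<omega>) 0 k \<le> K" by blast
  have "(\<lambda>z. z - d) ` {..<x} = {..<x - d}"
    by (auto simp: image_iff intro!: bexI[of _ "_ + d"])
  then have tr: "leave {..<x - d} (stacks (shift d \<omega>)) (- d) k (\<lambda>z. S' (z + d)) (v - d)"
    using leave_translate[OF k(2), of d] by (simp add: stacks_shift)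
  have "\<exists>b \<tau>. answers {..<0} (stacks (shift d \<omega>)) ((- d, b) # \<tau>) k \<and>
      answers {0..<x - d} (stacks (shift d \<omega>)) (chain b \<tau> (v - d)) k \<and>
      length \<tau> + 1 \<le> upcrossings 0 (stacks (shift d \<omega>)) (- d) k \<and> b \<in> {0..<int L} \<and>
      set \<tau> \<subseteq> {- int L..-1} \<times> {0..<int L}"
    using split_at_origin[OF tr, of L] d \<Delta> range by (auto simp: stacks_shift)
  then obtain b \<tau> where b: "answers {..<0} (stacks (shift d \<omega>)) ((- d, b) # \<tau>) k"
      "answers {0..<x - d} (stacks (shift d \<omega>)) (chain b \<tau> (v - d)) k"
      "length \<tau> + 1 \<le> upcrossings 0 (stacks (shift d \<omega>)) (- d) k" "b \<in> {0..<int L}"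
      "set \<tau> \<subseteq> {- int L..-1} \<times> {0..<int L}"
    by (elim exE conjE) (rule that)
  have "realizable L M b \<tau>" unfolding realizable_def
  proof (intro bexI exI conjI)
    show "answers {..<0} (stacks (shift d \<omega>)) ((- d, b) # \<tau>) k" by (rule b(1))
    show "- d < 0" using d(1) by simp
    show "shift d \<omega> \<in> environments L M" by (rule shift_in_environments[OF \<omega>])
  qed
  moreover have "length \<tau> \<le> K"
    using b(3) d(2) upcrossings_translate[of d "stacks \<omega>" 0 k] by (simp add: stacks_shift)
  ultimately have "(b, \<tau>) \<in> patterns L M K" using b(4,5) by (simp add: patterns_def)
  moreover have "right_part (x - d) b \<tau> n (shift d \<omega>)"
    unfolding right_part_def using v answers_mono[OF b(2) k(1)] by (intro exI[of _ "v - d"]) auto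
  ultimately show ?thesis using d(1) by blast
qed

text \<open>
Joined with the gadget, the part of the walk on the nonnegative sites becomes an advance that starts at the
leftmost site \<open>p\<close> of the gadget.
\<close>

lemma gadget_advance:
  assumes p: "p < 0" and y: "0 \<le> y" and G: "answers {p..<0} G ((p, b) # \<tau>) T"
    and eq: "\<And>z. z \<in> {p..<0} \<Longrightarrow> stacks \<omega> z = G z" and r: "right_part y b \<tau> n \<omega>"
  shows "advance (y - p) (n + T) (shift p \<omega>)"
proof -
  have "answers {p..<0} (stacks \<omega>) ((p, b) # \<tau>) T" by (rule answers_local[OF G eq])
  then obtain k S1 where k: "k \<le> T" "leave {p..<0} (stacks \<omega>) p k S1 b" "answers {p..<0} S1 \<tau> (T - k)"
    by auto
  from r obtain z where z: "y \<le> z" "answers {0..<y} (stacks \<omega>) (chain b \<tau> z) n"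
    unfolding right_part_def by blast
  have "answers {0..<y} S1 (chain b \<tau> z) n"
    by (rule answers_local[OF z(2)]) (use leave_outside[OF k(2)] in auto)
  from leave_of_answers[OF k(3) this z(1)] p y obtain k' S'
    where k': "k' \<le> (T - k) + n" "leave {p..<y} S1 b k' S' z" by auto
  have "leave {p..<y} (stacks \<omega>) p (k + k') S' z"
    by (rule leave_trans[OF k(2) k'(2)]) (use y in auto)
  moreover have "(\<lambda>z. z - p) ` {p..<y} = {0..<y - p}"
    by (auto simp: image_iff intro!: bexI[of _ "_ + p"])
  ultimately have "leave {0..<y - p} (stacks (shift p \<omega>)) 0 (k + k') (\<lambda>z. S' (z + p)) (z - p)"
    using leave_translate[of "{p..<y}" "stacks \<omega>" p "k + k'" S' z p] by (simp add: stacks_shift)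
  moreover have "y - p \<le> z - p" "k + k' \<le> n + T" using k k' z by auto
  ultimately show ?thesis unfolding advance_def exits_def by blast
qed

lemma abs_walk_le: "\<omega> \<in> environments L M \<Longrightarrow> \<bar>walk \<omega> n\<bar> \<le> int (L * n)"
proof (induction n)
  case (Suc n)
  then show ?case
    using environments_range[OF Suc.prems, of "(visits (walk \<omega>) n (walk \<omega> n), walk \<omega> n)"]
    by (auto simp: algebra_simps)
qed simp

lemma walk_depends: "depends_on L M {- int (L * n)..int (L * n)} (\<lambda>\<omega>. x \<le> walk \<omega> n)"
  unfolding depends_on_def
proof (intro ballI impI)
  fix \<omega> \<omega>' assume env: "\<omega> \<in> environments L M"
    and eq: "\<forall>z\<in>{- int (L * n)..int (L * n)}. stacks \<omega> z = stacks \<omega>' z"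
  have "walk \<omega> k = walk \<omega>' k" if "k \<le> n" for k
    using that
  proof (induction k rule: less_induct)
    case (less k)
    show ?case
    proof (cases k)
      case (Suc t)
      have same: "walk \<omega> i = walk \<omega>' i" if "i \<le> t" for i using less that Suc by auto
      have "visits (walk \<omega>) t (walk \<omega> t) = visits (walk \<omega>') t (walk \<omega>' t)"
        by (rule visits_cong) (use same in auto)
      moreover have "\<bar>walk \<omega> t\<bar> \<le> int (L * n)"
        using abs_walk_le[OF env, of t] less.prems Suc mult_le_mono2[of t n L] by linarith
      then have "walk \<omega> t \<in> {- int (L * n)..int (L * n)}" unfolding atLeastAtMost_iff by linarith
      then have "stacks \<omega> (walk \<omega> t) = stacks \<omega>' (walk \<omega> t)" using eq by blast
      ultimately show ?thesis using same[of t] Suc by (auto simp: stacks_def fun_eq_iff)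
    qed simp
  qed
  then show "(x \<le> walk \<omega> n) = (x \<le> walk \<omega>' n)" by simp
qed

context excited_walk
begin

definition advance_prob :: "int \<Rightarrow> nat \<Rightarrow> real" where
  "advance_prob x n = pr (advance x n)"

lemma pr_le_1: "pr E \<le> 1"
  unfolding pr_def by simp

lemma advance_prob_nonneg: "0 \<le> advance_prob x n" and advance_prob_le_1: "advance_prob x n \<le> 1"
  unfolding advance_prob_def by (simp add: pr_def, rule pr_le_1)

lemma advance_prob_mono: "y \<le> x \<Longrightarrow> n \<le> m \<Longrightarrow> advance_prob x n \<le> advance_prob y m"
  unfolding advance_prob_def by (rule pr_mono[OF _ advance_depends]) (use advance_mono in auto)

lemma advance_prob_trivial: "x \<le> 0 \<Longrightarrow> advance_prob x n = 1"
  unfolding advance_prob_def pr_def using prob_space by (simp add: advance_trivial)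

lemma pr_Ex_eq_sum:
  assumes Q: "finite Q" and dep: "\<And>q. q \<in> Q \<Longrightarrow> finite (F q)" "\<And>q. q \<in> Q \<Longrightarrow> depends_on L M (F q) (E q)"
    and disj: "\<And>q r \<omega>. E q \<omega> \<Longrightarrow> E r \<omega> \<Longrightarrow> q = r"
  shows "pr (\<lambda>\<omega>. \<exists>q\<in>Q. E q \<omega>) = (\<Sum>q\<in>Q. pr (E q))"
proof -
  have eq: "{\<omega> \<in> space P. \<exists>q\<in>Q. E q \<omega>} = (\<Union>q\<in>Q. {\<omega> \<in> space P. E q \<omega>})" by auto
  show ?thesis unfolding pr_def eq
  proof (rule finite_measure_finite_Union[OF Q])
    show "(\<lambda>q. {\<omega> \<in> space P. E q \<omega>}) ` Q \<subseteq> sets P"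
      using finite_dependence(1)[OF dep] by blast
    show "disjoint_family_on (\<lambda>q. {\<omega> \<in> space P. E q \<omega>}) Q"
      unfolding disjoint_family_on_def using disj by blast
  qed
qed

lemma pr_union_bound:
  assumes Q: "finite Q" and dep: "\<And>q. q \<in> Q \<Longrightarrow> finite (F q)" "\<And>q. q \<in> Q \<Longrightarrow> depends_on L M (F q) (E q)"
    and sub: "\<And>\<omega>. \<omega> \<in> environments L M \<Longrightarrow> E' \<omega> \<Longrightarrow> \<exists>q\<in>Q. E q \<omega>"
  shows "pr E' \<le> (\<Sum>q\<in>Q. pr (E q))"
proof -
  have meas: "(\<lambda>q. {\<omega> \<in> space P. E q \<omega>}) ` Q \<subseteq> sets P"
    using finite_dependence(1)[OF dep] by blast
  have "pr E' \<le> measure P (\<Union>q\<in>Q. {\<omega> \<in> space P. E q \<omega>})"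
    unfolding pr_def by (rule finite_measure_mono) (use sub Q meas in \<open>auto simp: space_P\<close>)
  also have "\<dots> \<le> (\<Sum>q\<in>Q. pr (E q))"
    unfolding pr_def by (rule finite_measure_subadditive_finite[OF Q meas])
  finally show ?thesis .
qed

text \<open>
A renewal at the first site \<open>q\<close> at or above \<open>x\<close>: the event that the interval is left at \<open>q\<close> depends on sites
below \<open>x\<close>, the event \<open>E\<close> seen from \<open>q\<close> on sites at and above \<open>q\<close>. The events for different \<open>q\<close> are
disjoint.
\<close>

lemma restart_bound:
  assumes x: "0 \<le> x" and F: "finite F" "F \<subseteq> {0..}" "depends_on L M F E"
    and T: "finite F'" "depends_on L M F' T"
    and imp: "\<And>\<omega> q. x \<le> q \<Longrightarrow> exits {0..<x} n q \<omega> \<Longrightarrow> E (shift q \<omega>) \<Longrightarrow> T \<omega>"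
  shows "advance_prob x n * pr E \<le> pr T"
proof -
  let ?Q = "{x..x + int L}"
  have det: "q = r" if "exits {0..<x} n q \<omega>" "exits {0..<x} n r \<omega>" for q r \<omega>
    using that leave_det unfolding exits_def by blast
  have dep: "depends_on L M ({0..<x} \<union> (\<lambda>z. z + q) ` F) (\<lambda>\<omega>. exits {0..<x} n q \<omega> \<and> E (shift q \<omega>))" for q
    by (intro depends_on_conj exits_depends depends_on_shift F)
  have "advance_prob x n \<le> (\<Sum>q\<in>?Q. pr (exits {0..<x} n q))"
    unfolding advance_prob_def
  proof (rule pr_union_bound[where F = "\<lambda>_. {0..<x}"])
    fix \<omega> assume \<omega>: "\<omega> \<in> environments L M" "advance x n \<omega>"
    then obtain v where v: "x \<le> v" "exits {0..<x} n v \<omega>" unfolding advance_def by blast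
    have r: "stacks \<omega> z j \<le> int L" for z j
      unfolding stacks_def using environments_range[OF \<omega>(1)] by auto
    obtain k S' where l: "leave {0..<x} (stacks \<omega>) 0 k S' v"
      using v(2) unfolding exits_def by blast
    have "v \<le> x + int L" by (rule leave_overshoot[OF l _ _ r]) (use x in auto)
    then show "\<exists>q\<in>?Q. exits {0..<x} n q \<omega>" using v by auto
  qed (auto intro: exits_depends)
  then have "advance_prob x n * pr E \<le> (\<Sum>q\<in>?Q. pr (exits {0..<x} n q)) * pr E"
    by (rule mult_right_mono) (simp add: pr_def)
  also have "\<dots> = (\<Sum>q\<in>?Q. pr (\<lambda>\<omega>. exits {0..<x} n q \<omega> \<and> E (shift q \<omega>)))"
    unfolding sum_distrib_right
  proof (rule sum.cong[OF refl])
    fix q assume "q \<in> ?Q"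
    then have "{0..<x} \<inter> (\<lambda>z. z + q) ` F = {}" using F(2) by auto
    then have "pr (\<lambda>\<omega>. exits {0..<x} n q \<omega> \<and> E (shift q \<omega>)) =
        pr (exits {0..<x} n q) * pr (\<lambda>\<omega>. E (shift q \<omega>))"
      by (intro pr_independent[OF _ exits_depends _ depends_on_shift[OF F(3)]]) (use F in auto)
    then show "pr (exits {0..<x} n q) * pr E = pr (\<lambda>\<omega>. exits {0..<x} n q \<omega> \<and> E (shift q \<omega>))"
      by (simp add: pr_shift[OF F(1,3)])
  qed
  also have "\<dots> = pr (\<lambda>\<omega>. \<exists>q\<in>?Q. exits {0..<x} n q \<omega> \<and> E (shift q \<omega>))"
    by (rule pr_Ex_eq_sum[symmetric, OF _ _ dep]) (use F det in auto)
  also have "\<dots> \<le> pr T"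
    by (rule pr_mono[OF T]) (use imp in auto)
  finally show ?thesis .
qed

lemma advance_prob_supermult:
  assumes "0 \<le> y"
  shows "advance_prob x n * advance_prob y m \<le> advance_prob (x + y) (n + m)"
proof (cases "0 \<le> x")
  case True
  have "advance_prob x n * pr (advance y m) \<le> pr (advance (x + y) (n + m))"
  proof (rule restart_bound[OF True _ _ advance_depends _ advance_depends])
    fix \<omega> q assume "x \<le> q" "exits {0..<x} n q \<omega>" "advance y m (shift q \<omega>)"
    from advance_glue[OF True this] show "advance (x + y) (n + m) \<omega>"
      by (rule advance_mono) (use \<open>x \<le> q\<close> in auto)
  qed auto
  then show ?thesis by (simp add: advance_prob_def)
next
  case False
  have "advance_prob x n * advance_prob y m \<le> 1 * advance_prob y m" by (intro mult_right_mono advance_prob_le_1 advance_prob_nonneg)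
  also have "1 * advance_prob y m \<le> advance_prob (x + y) (n + m)" using False by (simp add: advance_prob_mono)
  finally show ?thesis .
qed

text \<open>
Having reached \<open>[x, \<infinity>)\<close> at a fresh site, the walk stays there forever if all cookies of this site are 0. The
probability of this is the constant \<open>c\<close>.
\<close>

lemma stuck_bound: "\<exists>c>0. \<forall>x\<ge>0. \<forall>n. c * advance_prob x n \<le> pr (\<lambda>\<omega>. x \<le> walk \<omega> n)"
proof (intro exI conjI allI impI)
  let ?E = "\<lambda>\<omega>. \<forall>z\<in>{0}. stacks \<omega> z = (\<lambda>_. 0)"
  show "0 < pr ?E" by (rule pr_cylinder_pos) auto
  fix x :: int and n assume x: "0 \<le> x"
  have dep: "depends_on L M {0} ?E" unfolding depends_on_def by auto
  have "advance_prob x n * pr ?E \<le> pr (\<lambda>\<omega>. x \<le> walk \<omega> n)"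
  proof (rule restart_bound[OF x _ _ dep _ walk_depends])
    fix \<omega> q assume q: "x \<le> q" "exits {0..<x} n q \<omega>" "?E (shift q \<omega>)"
    then obtain k S' where k: "k \<le> n" "leave {0..<x} (stacks \<omega>) 0 k S' q" unfolding exits_def by blast
    have "\<omega> (j, q) = 0" for j using q(3) by (simp add: stacks_shift stacks_def fun_eq_iff)
    then have "walk \<omega> n = q" by (intro walk_stuck[OF leave_walk[OF k(2)] _ k(1)])
    then show "x \<le> walk \<omega> n" using q by simp
  qed auto
  then show "pr ?E * advance_prob x n \<le> pr (\<lambda>\<omega>. x \<le> walk \<omega> n)" by (simp add: mult.commute)
qed

lemma advance_prob_speed_pos: "0 < advance_prob (int L) 1"
proof -
  have "0 < pr (\<lambda>\<omega>. \<forall>z\<in>{0}. stacks \<omega> z = (\<lambda>_. int L))" by (rule pr_cylinder_pos) auto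
  also have "\<dots> \<le> pr (advance (int L) 1)"
  proof (rule pr_mono[OF _ advance_depends])
    fix \<omega> :: environment assume "\<forall>z\<in>{0}. stacks \<omega> z = (\<lambda>_. int L)"
    then have "leave {0..<int L} (stacks \<omega>) 0 (Suc 0) (pop 0 (stacks \<omega>)) (int L)"
      using L by (intro leave.move) (auto intro: leave.stop)
    then show "advance (int L) 1 \<omega>" unfolding advance_def exits_def by auto
  qed simp
  finally show ?thesis by (simp add: advance_prob_def)
qed

lemma advance_prob_speed: "advance_prob (int L) 1 ^ n \<le> advance_prob (int (L * n)) n"
proof (induction n)
  case (Suc n)
  have "advance_prob (int L) 1 ^ Suc n = advance_prob (int L) 1 ^ n * advance_prob (int L) 1" by simp
  also have "\<dots> \<le> advance_prob (int (L * n)) n * advance_prob (int L) 1" by (intro mult_right_mono Suc advance_prob_nonneg)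
  also have "\<dots> \<le> advance_prob (int (L * n) + int L) (n + 1)" by (rule advance_prob_supermult) simp
  finally show ?case by (simp add: algebra_simps)
qed (simp add: advance_prob_trivial)

lemma full_speed_bound: "pr (\<lambda>\<omega>. int (L * n) \<le> walk \<omega> n) \<le> advance_prob (int (L * n)) n"
  unfolding advance_prob_def
proof (rule pr_mono[OF _ advance_depends])
  fix \<omega> assume \<omega>: "\<omega> \<in> environments L M" "int (L * n) \<le> walk \<omega> n"
  then obtain k S' v where k: "k \<le> n" "leave {..<int (L * n)} (stacks \<omega>) 0 k S' v"
    using walk_exit[of \<omega> n "{..<int (L * n)}"] by auto
  have v: "int (L * n) \<le> v" using leave_notin[OF k(2)] by simp
  have "int L * int k \<le> int (L * n)" unfolding of_nat_mult using k by (intro mult_left_mono) auto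
  then have "leave {0..<int (L * n)} (stacks \<omega>) 0 k S' v"
    using v environments_range[OF \<omega>(1)] by (intro leave_full_speed[OF k(2), of "int L"]) (auto simp: stacks_def)
  then show "advance (int (L * n)) n \<omega>" using v k unfolding advance_def exits_def by blast
qed simp

text \<open>
The gadget lives on negative sites and is independent of what happens on the others; \<open>c\<close> is the
reciprocal of its probability and \<open>T\<close> the time that the walk spends in it.
\<close>

lemma pattern_bound:
  assumes "(b, \<tau>) \<in> patterns L M K"
  shows "\<exists>c>0. \<exists>T. \<forall>y\<ge>0. \<forall>n. pr (right_part y b \<tau> n) \<le> c * advance_prob y (n + T)"
proof -
  have b: "b \<in> {0..<int L}" "set \<tau> \<subseteq> {- int L..-1} \<times> {0..}" and "realizable L M b \<tau>"
    using assms by (auto simp: patterns_def)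
  then obtain \<omega>0 a n0 where \<omega>0: "\<omega>0 \<in> environments L M" "a < 0"
      "answers {..<0} (stacks \<omega>0) ((a, b) # \<tau>) n0"
    unfolding realizable_def by blast
  have "\<exists>G p T. p < 0 \<and> answers {p..<0} G ((p, b) # \<tau>) T \<and> (\<forall>z j. G z j \<in> {- int L..int L}) \<and>
     (\<forall>z j. p \<le> z \<longrightarrow> z < 0 \<longrightarrow> M - 1 \<le> j \<longrightarrow> G z j = G z (M - 1))"
  proof (rule leftmost_gadget[OF L M \<omega>0(3,2) _ b(2)])
    show "0 \<le> b" using b by simp
    show "stacks \<omega>0 z j \<in> {- int L..int L}" for z j
      unfolding stacks_def by (rule environments_range[OF \<omega>0(1)])
    show "stacks \<omega>0 z j = stacks \<omega>0 z (M - 1)" if "M - 1 \<le> j" for z j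
      unfolding stacks_def by (rule environments_stable[OF \<omega>0(1) that])
  qed
  then obtain G p T where "p < 0 \<and> answers {p..<0} G ((p, b) # \<tau>) T \<and>
     (\<forall>z j. G z j \<in> {- int L..int L}) \<and>
     (\<forall>z j. p \<le> z \<longrightarrow> z < 0 \<longrightarrow> M - 1 \<le> j \<longrightarrow> G z j = G z (M - 1))"
    by (elim exE)
  then have G: "p < 0" "answers {p..<0} G ((p, b) # \<tau>) T" "\<And>z j. G z j \<in> {- int L..int L}"
      "\<And>z j. z \<in> {p..<0} \<Longrightarrow> M - 1 \<le> j \<Longrightarrow> G z j = G z (M - 1)"
    unfolding atLeastLessThan_iff by blast+
  let ?E = "\<lambda>\<omega>. \<forall>z\<in>{p..<0}. stacks \<omega> z = G z"
  have dep: "depends_on L M {p..<0} ?E" unfolding depends_on_def by auto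
  have pos: "0 < pr ?E" by (rule pr_cylinder_pos[of "{p..<0}" G, OF _ G(3,4)]) simp_all
  have "pr (right_part y b \<tau> n) \<le> 1 / pr ?E * advance_prob y (n + T)" if y: "0 \<le> y" for y n
  proof -
    have "pr ?E * pr (right_part y b \<tau> n) = pr (\<lambda>\<omega>. ?E \<omega> \<and> right_part y b \<tau> n \<omega>)"
      by (rule pr_independent[symmetric, OF _ dep _ right_part_depends]) auto
    also have "\<dots> \<le> pr (\<lambda>\<omega>. advance (y - p) (n + T) (shift p \<omega>))"
      by (rule pr_mono[OF _ depends_on_shift[OF advance_depends]])
        (use gadget_advance[OF G(1) y G(2)] in auto)
    also have "\<dots> = advance_prob (y - p) (n + T)"
      unfolding advance_prob_def by (rule pr_shift[OF _ advance_depends]) simp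
    also have "\<dots> \<le> advance_prob y (n + T)" using G(1) by (intro advance_prob_mono) auto
    finally show ?thesis using pos by (simp add: field_simps)
  qed
  then show ?thesis using pos by (intro exI[of _ "1 / pr ?E"] conjI exI[of _ T]) auto
qed

text \<open>
Getting rid of backtracking. The constants depend on \<open>K\<close> only, since there are finitely many patterns;
\<open>\<Delta>\<close> is the number of levels that have to be tried for one to be crossed at most \<open>K\<close> times.
\<close>

lemma comparison:
  "\<exists>c\<ge>1. \<exists>T. \<forall>n \<Delta>. \<forall>x. 1 \<le> \<Delta> \<longrightarrow> L * n < \<Delta> * (K + 1) \<longrightarrow>
     pr (\<lambda>\<omega>. x \<le> walk \<omega> n) \<le> real \<Delta> * c * advance_prob (x - int \<Delta>) (n + T)"
proof -
  let ?P = "patterns L M K"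
  have "\<forall>\<pi>\<in>?P. \<exists>cT. fst cT > 0 \<and>
      (\<forall>y\<ge>0. \<forall>n. pr (right_part y (fst \<pi>) (snd \<pi>) n) \<le> fst cT * advance_prob y (n + snd cT))"
  proof
    fix \<pi> assume "\<pi> \<in> ?P"
    then obtain c T where "c > 0"
      "\<forall>y\<ge>0. \<forall>n. pr (right_part y (fst \<pi>) (snd \<pi>) n) \<le> c * advance_prob y (n + T)"
      using pattern_bound[of "fst \<pi>" "snd \<pi>" K] by auto
    then show "\<exists>cT. fst cT > 0 \<and>
        (\<forall>y\<ge>0. \<forall>n. pr (right_part y (fst \<pi>) (snd \<pi>) n) \<le> fst cT * advance_prob y (n + snd cT))"
      by (intro exI[of _ "(c, T)"]) simp
  qed
  from bchoice[OF this] obtain f where f: "\<And>\<pi>. \<pi> \<in> ?P \<Longrightarrow> fst (f \<pi>) > 0"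
    "\<And>\<pi> y n. \<pi> \<in> ?P \<Longrightarrow> 0 \<le> y \<Longrightarrow>
      pr (right_part y (fst \<pi>) (snd \<pi>) n) \<le> fst (f \<pi>) * advance_prob y (n + snd (f \<pi>))"
    by blast
  define c where "c = 1 + (\<Sum>\<pi>\<in>?P. fst (f \<pi>))"
  define T where "T = (\<Sum>\<pi>\<in>?P. snd (f \<pi>))"
  have sum0: "0 \<le> (\<Sum>\<pi>\<in>?P. fst (f \<pi>))" by (rule sum_nonneg) (use f(1) less_imp_le in blast)
  have "pr (\<lambda>\<omega>. x \<le> walk \<omega> n) \<le> real \<Delta> * c * advance_prob (x - int \<Delta>) (n + T)"
    if \<Delta>: "1 \<le> \<Delta>" "L * n < \<Delta> * (K + 1)" for n \<Delta> x
  proof (cases "int \<Delta> \<le> x")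
    case True
    let ?E = "\<lambda>(d, \<pi>) \<omega>. right_part (x - d) (fst \<pi>) (snd \<pi>) n (shift d \<omega>)"
    have "pr (\<lambda>\<omega>. x \<le> walk \<omega> n) \<le> (\<Sum>i\<in>{1..int \<Delta>} \<times> ?P. pr (?E i))"
    proof (rule pr_union_bound[where F = "\<lambda>(d, \<pi>). (\<lambda>z. z + d) ` {0..<x - d}"])
      fix \<omega> assume "\<omega> \<in> environments L M" "x \<le> walk \<omega> n"
      from few_crossings[OF this True \<Delta>(2)] obtain d b \<tau> where
        "d \<in> {1..int \<Delta>}" "(b, \<tau>) \<in> ?P" "right_part (x - d) b \<tau> n (shift d \<omega>)"
        by blast
      then show "\<exists>i\<in>{1..int \<Delta>} \<times> ?P. ?E i \<omega>"
        by (intro bexI[of _ "(d, (b, \<tau>))"]) auto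
    next
      fix i assume "i \<in> {1..int \<Delta>} \<times> ?P"
      show "depends_on L M (case i of (d, \<pi>) \<Rightarrow> (\<lambda>z. z + d) ` {0..<x - d}) (?E i)"
        by (cases i) (simp only: prod.case depends_on_shift[OF right_part_depends])
    qed (auto simp: finite_patterns)
    also have "\<dots> \<le> (\<Sum>(d, \<pi>)\<in>{1..int \<Delta>} \<times> ?P. fst (f \<pi>) * advance_prob (x - int \<Delta>) (n + T))"
    proof (rule sum_mono)
      fix i assume i: "i \<in> {1..int \<Delta>} \<times> ?P"
      obtain d \<pi> where d: "i = (d, \<pi>)" by (cases i)
      have \<pi>: "\<pi> \<in> ?P" using i d by auto
      have "pr (?E i) = pr (right_part (x - d) (fst \<pi>) (snd \<pi>) n)"
        unfolding d prod.case by (rule pr_shift[OF _ right_part_depends]) simp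
      also have "\<dots> \<le> fst (f \<pi>) * advance_prob (x - d) (n + snd (f \<pi>))"
        by (rule f(2)[OF \<pi>]) (use i d True in auto)
      also have "snd (f \<pi>) \<le> T" unfolding T_def
        by (rule member_le_sum[OF \<pi>]) (auto simp: finite_patterns)
      then have "advance_prob (x - d) (n + snd (f \<pi>)) \<le> advance_prob (x - int \<Delta>) (n + T)"
        using i d by (intro advance_prob_mono) auto
      then have "fst (f \<pi>) * advance_prob (x - d) (n + snd (f \<pi>)) \<le> fst (f \<pi>) * advance_prob (x - int \<Delta>) (n + T)"
        using f(1)[OF \<pi>] by simp
      finally show "pr (?E i) \<le> (case i of (d, \<pi>) \<Rightarrow> fst (f \<pi>) * advance_prob (x - int \<Delta>) (n + T))"
        by (simp add: d)
    qed
    also have "\<dots> = real \<Delta> * (\<Sum>\<pi>\<in>?P. fst (f \<pi>)) * advance_prob (x - int \<Delta>) (n + T)"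
      by (subst sum.cartesian_product[symmetric]) (simp add: sum_distrib_right mult.assoc)
    also have "\<dots> \<le> real \<Delta> * c * advance_prob (x - int \<Delta>) (n + T)"
      by (intro mult_right_mono mult_left_mono advance_prob_nonneg) (auto simp: c_def)
    finally show ?thesis .
  next
    case False
    have "1 * 1 \<le> real \<Delta> * c" using \<Delta>(1) sum0 by (intro mult_mono) (auto simp: c_def)
    then show ?thesis using pr_le_1[of "\<lambda>\<omega>. x \<le> walk \<omega> n"] False by (simp add: advance_prob_trivial)
  qed
  moreover have "1 \<le> c" using sum0 by (simp add: c_def)
  ultimately show ?thesis by blast
qed

end

section \<open>The limit\<close>

text \<open>
Fekete's lemma, together with the fact that the limit is an upper bound for \<open>a n / n\<close>.
\<close>

lemma superadditive_limit:
  fixes a :: "nat \<Rightarrow> real"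
  assumes super: "\<And>n m. a n + a m \<le> a (n + m)" and le: "\<And>n. a n \<le> 0"
    and ge: "\<And>n. - C * real n \<le> a n"
  shows "\<exists>\<phi>\<le>0. (\<forall>n. a n \<le> \<phi> * real n) \<and> (\<lambda>n. a n / real n) \<longlonglongrightarrow> \<phi>"
proof -
  define \<phi> where "\<phi> = (SUP n\<in>{1..}. a n / real n)"
  have bdd: "bdd_above ((\<lambda>n. a n / real n) ` {1..})"
    by (rule bdd_aboveI2[of _ _ 0]) (simp add: divide_le_0_iff le)
  have upper: "a n / real n \<le> \<phi>" if "1 \<le> n" for n
    unfolding \<phi>_def by (rule cSUP_upper[OF _ bdd]) (use that in simp)
  have "\<phi> \<le> 0" unfolding \<phi>_def
    by (rule cSUP_least) (auto simp: divide_le_0_iff le)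
  have upper': "a n \<le> \<phi> * real n" for n
    using upper[of n] le[of 0] by (cases "n = 0") (auto simp: field_simps)
  have mult: "real q * a m \<le> a (q * m)" if "a 0 = 0" for q m
  proof (induction q)
    case (Suc q)
    then show ?case using super[of m "q * m"] by (simp add: algebra_simps)
  qed (simp add: that)
  have a0: "a 0 = 0" using ge[of 0] le[of 0] by simp
  have C: "0 \<le> C" using ge[of 1] le[of 1] by simp
  have "(\<lambda>n. a n / real n) \<longlonglongrightarrow> \<phi>"
  proof (rule order_tendstoI)
    fix u assume "\<phi> < u"
    then show "\<forall>\<^sub>F n in sequentially. a n / real n < u"
      using upper by (intro eventually_sequentiallyI[of 1]) (auto intro: le_less_trans)
  next
    fix l assume "l < \<phi>"
    then obtain m where m: "1 \<le> m" "l < a m / real m"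
      unfolding \<phi>_def using less_cSUP_iff[OF _ bdd] by auto
    have bound: "a m / real m - C * real m / real n \<le> a n / real n" if "1 \<le> n" for n
    proof -
      define q r where "q = n div m" and "r = n mod m"
      have n: "n = q * m + r" and "r < m" using m by (auto simp: q_def r_def)
      have "C * real r \<le> C * real m" using C \<open>r < m\<close> by (intro mult_left_mono) auto
      then have "real q * a m - C * real m \<le> a n"
        using super[of "q * m" r] mult[OF a0, of q m] ge[of r] unfolding n by linarith
      moreover have "real n * (a m / real m) \<le> real q * a m"
      proof -
        have "real n * (a m / real m) = real q * a m + real r * (a m / real m)"
          using m by (simp add: n field_simps)
        also have "real r * (a m / real m) \<le> 0"
          by (intro mult_nonneg_nonpos) (auto simp: divide_le_0_iff le)
        finally show ?thesis by simp
      qed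
      ultimately have "real n * (a m / real m) - C * real m \<le> a n" by simp
      then have "(real n * (a m / real m) - C * real m) / real n \<le> a n / real n"
        by (rule divide_right_mono) simp
      then show ?thesis using that by (simp add: diff_divide_distrib)
    qed
    have "(\<lambda>n. a m / real m - C * real m / real n) \<longlonglongrightarrow> a m / real m - 0"
      by (intro tendsto_diff tendsto_const lim_const_over_n)
    then have "\<forall>\<^sub>F n in sequentially. l < a m / real m - C * real m / real n"
      using m(2) by (intro order_tendstoD(1)) auto
    then show "\<forall>\<^sub>F n in sequentially. l < a n / real n"
      using eventually_ge_at_top[of 1] by eventually_elim (use bound in force)
  qed
  then show ?thesis using \<open>\<phi> \<le> 0\<close> upper' by blast
qed

context excited_walk
begin

text \<open>
The rate is the one of \<open>advance_prob\<close> along \<open>\<lceil>lam n\<rceil>\<close>. For \<open>lam = L\<close> the walk cannot turn back at all. For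
\<open>lam < L\<close> the loss in \<open>comparison\<close> is compensated by running at full speed \<open>L\<close> for \<open>\<delta>\<close> additional steps,
which gains the distance \<open>(L - lam) \<delta>\<close> on the line of slope \<open>lam\<close>. It suffices that \<open>\<delta>\<close> is about
\<open>\<Delta> / (L - lam)\<close>, a fraction of \<open>n\<close> that tends to 0 as \<open>K\<close> grows.
\<close>

lemma rate_exists:
  assumes lam: "0 \<le> lam" "lam \<le> real L"
  shows "\<exists>\<phi>\<le>0. (\<lambda>n. 1 / real n * ln (pr (\<lambda>\<omega>. \<lceil>lam * real n\<rceil> \<le> walk \<omega> n))) \<longlonglongrightarrow> \<phi>"
proof -
  define a where "a n = ln (advance_prob \<lceil>lam * real n\<rceil> n)" for n
  define p where "p n = pr (\<lambda>\<omega>. \<lceil>lam * real n\<rceil> \<le> walk \<omega> n)" for n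
  define \<kappa> where "\<kappa> = advance_prob (int L) 1"
  define B where "B = - ln \<kappa>"
  have \<kappa>: "0 < \<kappa>" "\<kappa> \<le> 1" unfolding \<kappa>_def by (rule advance_prob_speed_pos, rule advance_prob_le_1)
  have B: "0 \<le> B" using \<kappa> by (simp add: B_def)
  have h_ge: "\<kappa> ^ n \<le> advance_prob \<lceil>lam * real n\<rceil> n" for n
  proof -
    have "lam * real n \<le> real L * real n" using lam by (intro mult_right_mono) auto
    then have "\<lceil>lam * real n\<rceil> \<le> int (L * n)" by (simp add: ceiling_le_iff)
    then show ?thesis using advance_prob_speed[of n] advance_prob_mono[of "\<lceil>lam * real n\<rceil>" "int (L * n)" n n]
      by (simp add: \<kappa>_def)
  qed
  have h_pos: "0 < advance_prob \<lceil>lam * real n\<rceil> n" for n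
    using h_ge[of n] \<kappa> by (meson less_le_trans zero_less_power)
  have nn: "0 \<le> \<lceil>lam * real n\<rceil>" for n
    using lam by (simp add: zero_le_mult_iff le_ceiling_iff order_less_le_trans[of "-1" 0])
  have a_le: "a n \<le> 0" for n using h_pos[of n] advance_prob_le_1 by (simp add: a_def)
  have a_ge: "- B * real n \<le> a n" for n
  proof -
    have "ln (\<kappa> ^ n) \<le> a n" unfolding a_def using h_ge h_pos \<kappa> by (subst ln_le_cancel_iff) auto
    then show ?thesis using \<kappa> by (simp add: ln_realpow B_def mult.commute)
  qed
  have a_super: "a n + a m \<le> a (n + m)" for n m
  proof -
    have "advance_prob \<lceil>lam * real n\<rceil> n * advance_prob \<lceil>lam * real m\<rceil> m \<le> advance_prob (\<lceil>lam * real n\<rceil> + \<lceil>lam * real m\<rceil>) (n + m)"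
      by (rule advance_prob_supermult[OF nn])
    also have "\<lceil>lam * real (n + m)\<rceil> \<le> \<lceil>lam * real n\<rceil> + \<lceil>lam * real m\<rceil>"
      using ceiling_add_le[of "lam * real n" "lam * real m"] by (simp add: algebra_simps)
    then have "advance_prob (\<lceil>lam * real n\<rceil> + \<lceil>lam * real m\<rceil>) (n + m) \<le> advance_prob \<lceil>lam * real (n + m)\<rceil> (n + m)"
      by (rule advance_prob_mono) simp
    finally have "ln (advance_prob \<lceil>lam * real n\<rceil> n * advance_prob \<lceil>lam * real m\<rceil> m) \<le> a (n + m)"
      unfolding a_def by (subst ln_le_cancel_iff) (simp_all only: mult_pos_pos h_pos)
    then show ?thesis unfolding a_def using h_pos[of n] h_pos[of m] by (simp add: ln_mult)
  qed
  from superadditive_limit[of a B, OF a_super a_le a_ge]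
  obtain \<phi> where \<phi>: "\<phi> \<le> 0" "\<And>n. a n \<le> \<phi> * real n" "(\<lambda>n. a n / real n) \<longlonglongrightarrow> \<phi>" by blast
  obtain c0 where c0: "0 < c0" "\<And>x n. 0 \<le> x \<Longrightarrow> c0 * advance_prob x n \<le> pr (\<lambda>\<omega>. x \<le> walk \<omega> n)"
    using stuck_bound by blast
  have p_ge: "c0 * advance_prob \<lceil>lam * real n\<rceil> n \<le> p n" for n unfolding p_def by (rule c0(2)[OF nn])
  have p_pos: "0 < p n" for n using p_ge[of n] c0(1) h_pos[of n] by (meson less_le_trans mult_pos_pos)
  have lower: "(ln c0 + a n) / real n \<le> 1 / real n * ln (p n)" for n
  proof -
    have "ln (c0 * advance_prob \<lceil>lam * real n\<rceil> n) \<le> ln (p n)"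
      using p_ge p_pos c0(1) h_pos by (subst ln_le_cancel_iff) auto
    then have "ln c0 + a n \<le> ln (p n)" using c0(1) h_pos[of n] by (simp add: a_def ln_mult)
    then show ?thesis by (simp add: divide_right_mono)
  qed
  have upper: "\<forall>\<^sub>F n in sequentially. 1 / real n * ln (p n) < u" if u: "\<phi> < u" for u
  proof (cases "lam = real L")
    case True
    have "ln (p n) \<le> \<phi> * real n" for n
    proof -
      have "\<lceil>lam * real n\<rceil> = int (L * n)" unfolding True by (simp flip: of_nat_mult)
      then have "p n \<le> advance_prob \<lceil>lam * real n\<rceil> n" using full_speed_bound[of n] by (simp add: p_def)
      then have "ln (p n) \<le> a n" unfolding a_def using p_pos h_pos by (subst ln_le_cancel_iff) auto
      then show ?thesis using \<phi>(2)[of n] by simp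
    qed
    then have "1 / real n * ln (p n) \<le> \<phi>" if "1 \<le> n" for n
      using that by (simp add: field_simps)
    then show ?thesis using u by (intro eventually_sequentiallyI[of 1]) (auto intro: le_less_trans)
  next
    case False
    then have gap: "0 < real L - lam" using lam by simp
    \<comment> \<open>With this \<open>K\<close> the cost of the additional steps is less than half of the gap between \<open>u\<close> and \<open>\<phi>\<close>.\<close>
    obtain K :: nat where K: "B * real L / (real L - lam) / ((u - \<phi>) / 2) < real K"
      using reals_Archimedean2 by blast
    define \<alpha> where "\<alpha> = real L / real (K + 1) / (real L - lam)"
    have \<alpha>: "B * \<alpha> < (u - \<phi>) / 2"
    proof -
      have w: "0 < (u - \<phi>) / 2" using u by simp
      have "B * real L / (real L - lam) < real K * ((u - \<phi>) / 2)"
        using K by (simp only: pos_divide_less_eq[OF w])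
      also have "\<dots> \<le> real (K + 1) * ((u - \<phi>) / 2)" using w by (intro mult_right_mono) auto
      finally have "B * real L / (real L - lam) / real (K + 1) < (u - \<phi>) / 2"
        by (subst pos_divide_less_eq) (simp_all add: mult.commute)
      moreover have "B * \<alpha> = B * real L / (real L - lam) / real (K + 1)"
        unfolding \<alpha>_def by (simp add: mult.commute)
      ultimately show ?thesis by (simp only:)
    qed
    obtain c T where c: "1 \<le> c" and comp: "\<And>n \<Delta> x. 1 \<le> \<Delta> \<Longrightarrow> L * n < \<Delta> * (K + 1) \<Longrightarrow>
        pr (\<lambda>\<omega>. x \<le> walk \<omega> n) \<le> real \<Delta> * c * advance_prob (x - int \<Delta>) (n + T)"
      using comparison[of K] by blast
    define \<beta> where "\<beta> = (lam * real T + 1) / (real L - lam) + 1"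
    have bound: "1 / real n * ln (p n) \<le>
        \<phi> + B * \<alpha> + (ln (real (L + 1) * c) / real n + ln (real n) / real n + B * \<beta> / real n)"
      if n: "1 \<le> n" for n
    proof -
      define \<Delta> where "\<Delta> = L * n div (K + 1) + 1"
      \<comment> \<open>\<open>\<delta>\<close> steps at full speed suffice to bring the walk back to the line of slope \<open>lam\<close>.\<close>
      define \<delta> where "\<delta> = nat \<lceil>(lam * real T + real \<Delta>) / (real L - lam)\<rceil>"
      define N where "N = n + T + \<delta>"
      have \<Delta>1: "1 \<le> \<Delta>" by (simp add: \<Delta>_def)
      have \<Delta>2: "L * n < \<Delta> * (K + 1)"
        using dividend_less_div_times[of "K + 1" "L * n"] unfolding \<Delta>_def add_mult_distrib[of _ 1]
        by (simp only: add_gr_0 zero_less_one mult_1 add.commute simp_thms)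
      have \<Delta>3: "real \<Delta> \<le> real L * real n / real (K + 1) + 1"
        using of_nat_div_le_of_nat[of "L * n" "K + 1", where 'a = real] by (simp add: \<Delta>_def)
      have \<Delta>4: "real \<Delta> \<le> real (L + 1) * real n"
      proof -
        have "\<Delta> \<le> L * n + 1" by (simp add: \<Delta>_def)
        also have "\<dots> \<le> (L + 1) * n" using n by simp
        finally show ?thesis by (metis of_nat_le_iff of_nat_mult)
      qed
      have q0: "0 \<le> (lam * real T + real \<Delta>) / (real L - lam)" using lam gap by simp
      have \<delta>1: "(lam * real T + real \<Delta>) / (real L - lam) \<le> real \<delta>"
        unfolding \<delta>_def by (rule real_nat_ceiling_ge)
      have \<delta>2: "real \<delta> \<le> \<alpha> * real n + \<beta>"
      proof -
        have "real \<delta> \<le> (lam * real T + real \<Delta>) / (real L - lam) + 1"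
          unfolding \<delta>_def using q0 by linarith
        also have "\<dots> \<le> (lam * real T + (real L * real n / real (K + 1) + 1)) / (real L - lam) + 1"
          using \<Delta>3 gap by (intro add_right_mono divide_right_mono) auto
        also have "\<dots> = \<alpha> * real n + \<beta>"
          unfolding \<alpha>_def \<beta>_def by (simp add: add_divide_distrib mult.commute)
        finally show ?thesis .
      qed
      have "lam * real T + real \<Delta> \<le> real \<delta> * (real L - lam)"
        using \<delta>1 gap by (simp add: divide_le_eq)
      then have "lam * real N \<le> lam * real n - real \<Delta> + real L * real \<delta>"
        unfolding N_def by (simp add: algebra_simps)
      also have "\<dots> \<le> of_int (\<lceil>lam * real n\<rceil> - int \<Delta> + int (L * \<delta>))" by simp
      finally have N: "\<lceil>lam * real N\<rceil> \<le> \<lceil>lam * real n\<rceil> - int \<Delta> + int (L * \<delta>)"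
        by (simp only: ceiling_le_iff)
      let ?h = "advance_prob (\<lceil>lam * real n\<rceil> - int \<Delta>) (n + T)"
      have "?h * \<kappa> ^ \<delta> \<le> ?h * advance_prob (int (L * \<delta>)) \<delta>"
        unfolding \<kappa>_def by (intro mult_left_mono advance_prob_speed advance_prob_nonneg)
      also have "\<dots> \<le> advance_prob (\<lceil>lam * real n\<rceil> - int \<Delta> + int (L * \<delta>)) (n + T + \<delta>)"
        by (rule advance_prob_supermult) simp
      also have "\<dots> \<le> advance_prob \<lceil>lam * real N\<rceil> N" unfolding N_def[symmetric] by (rule advance_prob_mono[OF N order_refl])
      finally have hk: "?h * \<kappa> ^ \<delta> \<le> advance_prob \<lceil>lam * real N\<rceil> N" .
      have dc: "0 < real \<Delta> * c" using \<Delta>1 c by simp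
      have "p n \<le> real \<Delta> * c * ?h" unfolding p_def by (rule comp[OF \<Delta>1 \<Delta>2])
      then have "p n * \<kappa> ^ \<delta> \<le> real \<Delta> * c * ?h * \<kappa> ^ \<delta>" using \<kappa> by (intro mult_right_mono) auto
      also have "\<dots> = real \<Delta> * c * (?h * \<kappa> ^ \<delta>)" by simp
      also have "\<dots> \<le> real \<Delta> * c * advance_prob \<lceil>lam * real N\<rceil> N" using hk dc by (intro mult_left_mono) auto
      finally have "ln (p n * \<kappa> ^ \<delta>) \<le> ln (real \<Delta> * c * advance_prob \<lceil>lam * real N\<rceil> N)"
        using p_pos \<kappa> dc h_pos by (subst ln_le_cancel_iff) auto
      then have "ln (p n) - real \<delta> * B \<le> ln (real \<Delta> * c) + a N"
        using \<kappa> ln_mult_pos[OF p_pos zero_less_power[OF \<kappa>(1)], of n \<delta>] ln_mult_pos[OF dc h_pos, of N]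
        by (simp only: a_def B_def ln_realpow)
      moreover have "a N \<le> \<phi> * real n"
      proof -
        have "\<phi> * real N \<le> \<phi> * real n" using \<phi>(1) by (intro mult_left_mono_neg) (auto simp: N_def)
        then show ?thesis using \<phi>(2)[of N] by simp
      qed
      moreover have "ln (real \<Delta> * c) \<le> ln (real (L + 1) * c) + ln (real n)"
      proof -
        have "real \<Delta> * c \<le> real (L + 1) * real n * c" using \<Delta>4 c by (intro mult_right_mono) auto
        also have "\<dots> = real (L + 1) * c * real n" by simp
        finally have "ln (real \<Delta> * c) \<le> ln (real (L + 1) * c * real n)"
          using dc c n by (subst ln_le_cancel_iff) auto
        then show ?thesis using c n by (simp add: ln_mult)
      qed
      moreover have "real \<delta> * B \<le> (\<alpha> * real n + \<beta>) * B" by (rule mult_right_mono[OF \<delta>2 B])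
      ultimately have "ln (p n) \<le> ln (real (L + 1) * c) + ln (real n) + \<phi> * real n + (\<alpha> * real n + \<beta>) * B"
        by linarith
      then have "ln (p n) / real n \<le>
          (ln (real (L + 1) * c) + ln (real n) + \<phi> * real n + (\<alpha> * real n + \<beta>) * B) / real n"
        by (rule divide_right_mono) simp
      also have "\<dots> = \<phi> + B * \<alpha> + (ln (real (L + 1) * c) / real n + ln (real n) / real n + B * \<beta> / real n)"
        using n by (simp add: field_simps)
      finally show ?thesis by simp
    qed
    have "(\<lambda>n. \<phi> + B * \<alpha> + (ln (real (L + 1) * c) / real n + ln (real n) / real n + B * \<beta> / real n))
        \<longlonglongrightarrow> \<phi> + B * \<alpha> + (0 + 0 + 0)"
      by (intro tendsto_add tendsto_const lim_const_over_n lim_ln_over_n)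
    moreover have "\<phi> + B * \<alpha> + (0 + 0 + 0) < u" using \<alpha> u by (simp add: field_simps)
    ultimately have "\<forall>\<^sub>F n in sequentially.
        \<phi> + B * \<alpha> + (ln (real (L + 1) * c) / real n + ln (real n) / real n + B * \<beta> / real n) < u"
      by (rule order_tendstoD(2))
    then show ?thesis using eventually_ge_at_top[of 1]
      by eventually_elim (use bound in \<open>force intro: le_less_trans\<close>)
  qed
  have "(\<lambda>n. 1 / real n * ln (p n)) \<longlonglongrightarrow> \<phi>"
  proof (rule order_tendstoI[OF _ upper])
    fix l assume l: "l < \<phi>"
    have "(\<lambda>n. ln c0 / real n + a n / real n) \<longlonglongrightarrow> 0 + \<phi>"
      by (intro tendsto_add lim_const_over_n \<phi>(3))
    then have "\<forall>\<^sub>F n in sequentially. l < ln c0 / real n + a n / real n"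
      using l by (intro order_tendstoD(1)) auto
    then show "\<forall>\<^sub>F n in sequentially. l < 1 / real n * ln (p n)"
      by eventually_elim (use lower in \<open>force simp: add_divide_distrib intro: less_le_trans\<close>)
  qed
  then show ?thesis using \<phi>(1) unfolding p_def by blast
qed

end

theorem theorem1:
  fixes L M :: nat and \<mu> :: "int pmf" and P :: "environment measure"
  assumes "L \<ge> 1" and "M \<ge> 3"
    and "set_pmf \<mu> = {- int L..int L}"
    and "iid_cookie_measure L M \<mu> P"
  shows "\<exists>\<phi> :: real \<Rightarrow> real. \<forall>x\<in>{0..real L}. \<phi> x \<le> 0 \<and>
    (\<lambda>n. 1 / real n * ln (measure P {\<omega> \<in> space P. real_of_int (walk \<omega> n) \<ge> x * real n}))
      \<longlonglongrightarrow> \<phi> x"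
proof -
  interpret excited_walk L M \<mu> P
    using assms by unfold_locales
  have "\<forall>x\<in>{0..real L}. \<exists>\<phi>. \<phi> \<le> 0 \<and>
    (\<lambda>n. 1 / real n * ln (measure P {\<omega> \<in> space P. real_of_int (walk \<omega> n) \<ge> x * real n}))
      \<longlonglongrightarrow> \<phi>"
    using rate_exists by (auto simp: pr_def ceiling_le_iff)
  then show ?thesis by (rule bchoice)
qed

end
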